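(* Let $\mathbb{E}$ be a regular category admitting suprema of chains of subobjects which are stable under pullback along any split epimorphism. Then $\mathbb{E}$ has suprema of chains of reflexive relations (among the reflexive relations on the same object) which are stable under composition of reflexive relations. Accordingly, $\mathbb{E}$ has suprema of pairs of preorders (among the preorders on the same object) and of pairs of equivalence relations (among the equivalence relations on the same object), and the associated cocartesian maps: above any regular epimorphism $f:X\to Y$ in $\mathbb{E}$ there is a cocartesian map with respect to $(\;)_0$ in $PrO\,\mathbb{E}$ (resp. in $Equ\,\mathbb{E}$) with any domain on $X$ in $PrO\,\mathbb{E}$ (resp. in $Equ\,\mathbb{E}$).
   Context: A chain of subobjects of $X$ is an increasing sequence $(A_i)_{i\in\mathbb{N}}$ of subobjects of $X$; its supremum is taken in the ordered set of subobjects of $X$, and is stable under pullback along $g:Z\to X$ when $g^{*}$ sends it to the supremum of the chain $(g^{*}A_i)_{i\in\mathbb{N}}$. A relation on $X$ is (a class up to isomorphism of) a subobject $R\rightarrowtail X\times X$, ordered by inclusion. In a regular category relations compose: $SR=S\circ R$ is the usual composite relation ($x(SR)z$ iff there is $y$ with $xRy$ and $ySz$), defined by a pullback followed by the regular epi–mono factorization. $R$ is reflexive if $\Delta_X\subset R$, symmetric if $R^{op}\subset R$, transitive if $R\circ R\subset R$; a preorder is a reflexive transitive relation, an equivalence relation is a symmetric preorder. A chain of reflexive relations on $X$ is an increasing sequence $(R_i)_{i\in\mathbb{N}}$ of reflexive relations on $X$; $\Sigma_{i\in\mathbb{N}}R_i$ denotes its supremum in the ordered set of reflexive relations on $X$.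 These suprema are stable under composition of reflexive relations when $\Sigma_{i\in\mathbb{N}}(R_iT)=(\Sigma_{i\in\mathbb{N}}R_i)T$ for every such chain and every reflexive relation $T$ on $X$. $Ref\,\mathbb{E}$ is the category whose objects are pairs (object $X$, reflexive relation $R$ on $X$) and in which a morphism $R\to S$ above $f:X\to Y$ exists (and is unique) iff $R\subset f^{-1}(S)$, where $f^{-1}(S)$ is the pullback of $S$ along $f\times f$; $(\;)_0$ sends $R$ to its ground object. $PrO\,\mathbb{E}$ and $Equ\,\mathbb{E}$ are its full subcategories of preorders and of equivalence relations. Given a functor $U:\mathbb{C}\to\mathbb{D}$, a map $f:X\to Z$ of $\mathbb{C}$ is cocartesian with respect to $U$ when, for every $\phi:X\to W$ with $U(\phi)=U(f)$, there is a unique $\psi:Z\to W$ with $\psi f=\phi$ and $U(\psi)=1_{U(Z)}$. *)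

theory Defs
  imports "HOL-Algebra.Order"
begin

section \<open>Categories\<close>

record ('o, 'a) cat =
  Obj :: "'o set"
  Arr :: "'a set"
  Dom :: "'a \<Rightarrow> 'o"
  Cod :: "'a \<Rightarrow> 'o"
  Ide :: "'o \<Rightarrow> 'a"
  Comp :: "'a \<Rightarrow> 'a \<Rightarrow> 'a"  (infixl \<open>\<cdot>\<index>\<close> 75)

definition Hom :: "('o, 'a, 'm) cat_scheme \<Rightarrow> 'o \<Rightarrow> 'o \<Rightarrow> 'a set" where
  "Hom C X Y = {f \<in> Arr C. Dom C f = X \<and> Cod C f = Y}"

locale category =
  fixes C (structure)
  assumes Dom_Obj: "f \<in> Arr C \<Longrightarrow> Dom C f \<in> Obj C"
    and Cod_Obj: "f \<in> Arr C \<Longrightarrow> Cod C f \<in> Obj C"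
    and Ide_Hom: "X \<in> Obj C \<Longrightarrow> Ide C X \<in> Hom C X X"
    and Comp_Hom: "f \<in> Hom C X Y \<Longrightarrow> g \<in> Hom C Y Z \<Longrightarrow> g \<cdot> f \<in> Hom C X Z"
    and Comp_Ide: "f \<in> Hom C X Y \<Longrightarrow> f \<cdot> Ide C X = f"
    and Ide_Comp: "f \<in> Hom C X Y \<Longrightarrow> Ide C Y \<cdot> f = f"
    and Comp_assoc:
      "f \<in> Hom C W X \<Longrightarrow> g \<in> Hom C X Y \<Longrightarrow> h \<in> Hom C Y Z \<Longrightarrow> (h \<cdot> g) \<cdot> f = h \<cdot> (g \<cdot> f)"

definition full_subcategory :: "('o, 'a) cat \<Rightarrow> 'o set \<Rightarrow> ('o, 'a) cat" where
  "full_subcategory C A =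
     C\<lparr>Obj := Obj C \<inter> A, Arr := {f \<in> Arr C. Dom C f \<in> A \<and> Cod C f \<in> A}\<rparr>"

text \<open>\<open>Uo\<close> and \<open>Ua\<close> are the object and arrow parts of a functor from \<open>C\<close> to \<open>D\<close>.\<close>

definition cocartesian ::
  "('o, 'a, 'm) cat_scheme \<Rightarrow> ('p, 'b, 'n) cat_scheme \<Rightarrow> ('o \<Rightarrow> 'p) \<Rightarrow> ('a \<Rightarrow> 'b) \<Rightarrow> 'a \<Rightarrow> bool" where
  "cocartesian C D Uo Ua f \<longleftrightarrow> f \<in> Arr C \<and>
     (\<forall>\<phi>\<in>Arr C. Dom C \<phi> = Dom C f \<and> Ua \<phi> = Ua f \<longrightarrow>
        (\<exists>!\<psi>. \<psi> \<in> Hom C (Cod C f) (Cod C \<phi>) \<and> \<psi> \<cdot>\<^bsub>C\<^esub> f = \<phi> \<and> Ua \<psi> = Ide D (Uo (Cod C f))))"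


section \<open>Regular categories\<close>

definition is_mono :: "('o, 'a, 'm) cat_scheme \<Rightarrow> 'a \<Rightarrow> bool" where
  "is_mono C m \<longleftrightarrow> m \<in> Arr C \<and>
     (\<forall>f\<in>Arr C. \<forall>g\<in>Arr C. Dom C f = Dom C g \<and> Cod C f = Dom C m \<and> Cod C g = Dom C m \<and>
        m \<cdot>\<^bsub>C\<^esub> f = m \<cdot>\<^bsub>C\<^esub> g \<longrightarrow> f = g)"

definition split_epi :: "('o, 'a, 'm) cat_scheme \<Rightarrow> 'a \<Rightarrow> bool" where
  "split_epi C g \<longleftrightarrow> g \<in> Arr C \<and> (\<exists>s\<in>Hom C (Cod C g) (Dom C g). g \<cdot>\<^bsub>C\<^esub> s = Ide C (Cod C g))"

definition is_coequalizer :: "('o, 'a, 'm) cat_scheme \<Rightarrow> 'a \<Rightarrow> 'a \<Rightarrow> 'a \<Rightarrow> bool" where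
  "is_coequalizer C f g q \<longleftrightarrow>
     f \<in> Arr C \<and> g \<in> Arr C \<and> q \<in> Arr C \<and>
     Dom C f = Dom C g \<and> Cod C f = Cod C g \<and> Dom C q = Cod C f \<and> q \<cdot>\<^bsub>C\<^esub> f = q \<cdot>\<^bsub>C\<^esub> g \<and>
     (\<forall>h\<in>Arr C. Dom C h = Cod C f \<and> h \<cdot>\<^bsub>C\<^esub> f = h \<cdot>\<^bsub>C\<^esub> g \<longrightarrow>
        (\<exists>!u. u \<in> Hom C (Cod C q) (Cod C h) \<and> u \<cdot>\<^bsub>C\<^esub> q = h))"

definition regular_epi :: "('o, 'a, 'm) cat_scheme \<Rightarrow> 'a \<Rightarrow> bool" where
  "regular_epi C q \<longleftrightarrow> (\<exists>f g. is_coequalizer C f g q)"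

definition is_terminal :: "('o, 'a, 'm) cat_scheme \<Rightarrow> 'o \<Rightarrow> bool" where
  "is_terminal C T \<longleftrightarrow> T \<in> Obj C \<and> (\<forall>X\<in>Obj C. \<exists>!f. f \<in> Hom C X T)"

definition is_product :: "('o, 'a, 'm) cat_scheme \<Rightarrow> 'o \<Rightarrow> 'o \<Rightarrow> 'a \<Rightarrow> 'a \<Rightarrow> bool" where
  "is_product C X Y p q \<longleftrightarrow>
     p \<in> Arr C \<and> q \<in> Arr C \<and> Dom C p = Dom C q \<and> Cod C p = X \<and> Cod C q = Y \<and>
     (\<forall>Z. \<forall>f\<in>Hom C Z X. \<forall>g\<in>Hom C Z Y.
        \<exists>!u. u \<in> Hom C Z (Dom C p) \<and> p \<cdot>\<^bsub>C\<^esub> u = f \<and> q \<cdot>\<^bsub>C\<^esub> u = g)"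

definition is_pullback :: "('o, 'a, 'm) cat_scheme \<Rightarrow> 'a \<Rightarrow> 'a \<Rightarrow> 'a \<Rightarrow> 'a \<Rightarrow> bool" where
  "is_pullback C f g p q \<longleftrightarrow>
     f \<in> Arr C \<and> g \<in> Arr C \<and> p \<in> Arr C \<and> q \<in> Arr C \<and>
     Cod C f = Cod C g \<and> Dom C p = Dom C q \<and> Cod C p = Dom C f \<and> Cod C q = Dom C g \<and>
     f \<cdot>\<^bsub>C\<^esub> p = g \<cdot>\<^bsub>C\<^esub> q \<and>
     (\<forall>Z. \<forall>h\<in>Hom C Z (Dom C f). \<forall>k\<in>Hom C Z (Dom C g). f \<cdot>\<^bsub>C\<^esub> h = g \<cdot>\<^bsub>C\<^esub> k \<longrightarrow>
        (\<exists>!u. u \<in> Hom C Z (Dom C p) \<and> p \<cdot>\<^bsub>C\<^esub> u = h \<and> q \<cdot>\<^bsub>C\<^esub> u = k))"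

text \<open>Finite completeness is stated as a terminal object and all pullbacks. A kernel pair of \<open>f\<close>
  is a pullback of \<open>f\<close> along itself.\<close>

locale regular_category = category +
  assumes has_terminal: "\<exists>T. is_terminal C T"
    and has_pullbacks:
      "f \<in> Arr C \<Longrightarrow> g \<in> Arr C \<Longrightarrow> Cod C f = Cod C g \<Longrightarrow> \<exists>p q. is_pullback C f g p q"
    and kernel_pair_coequalizer: "is_pullback C f f p q \<Longrightarrow> \<exists>c. is_coequalizer C p q c"
    and regular_epi_stable: "regular_epi C f \<Longrightarrow> is_pullback C g f p q \<Longrightarrow> regular_epi C p"


section \<open>Subobjects and relations\<close>

text \<open>A subobject of \<open>X\<close> is represented by a monomorphism into \<open>X\<close>. The field \<open>eq\<close> of the
  order structures below is isomorphism of subobjects, so that suprema (\<open>is_lub\<close>) are those of the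
  ordered set of isomorphism classes. Limits and images are chosen by \<open>SOME\<close>; each is used only
  up to isomorphism.\<close>

definition sub_le :: "('o, 'a, 'm) cat_scheme \<Rightarrow> 'a \<Rightarrow> 'a \<Rightarrow> bool" where
  "sub_le C m n \<longleftrightarrow> (\<exists>h\<in>Hom C (Dom C m) (Dom C n). n \<cdot>\<^bsub>C\<^esub> h = m)"

definition sub_order :: "('o, 'a, 'm) cat_scheme \<Rightarrow> 'a set \<Rightarrow> 'a gorder" where
  "sub_order C S = \<lparr>carrier = S, eq = (\<lambda>m n. sub_le C m n \<and> sub_le C n m), le = sub_le C\<rparr>"

definition Sub :: "('o, 'a, 'm) cat_scheme \<Rightarrow> 'o \<Rightarrow> 'a gorder" where
  "Sub C X = sub_order C {m. is_mono C m \<and> Cod C m = X}"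

definition is_chain :: "('a, 'm) gorder_scheme \<Rightarrow> (nat \<Rightarrow> 'a) \<Rightarrow> bool" where
  "is_chain L A \<longleftrightarrow> (\<forall>i. A i \<in> carrier L) \<and> (\<forall>i j. i \<le> j \<longrightarrow> A i \<sqsubseteq>\<^bsub>L\<^esub> A j)"

definition is_chain_sup :: "('a, 'm) gorder_scheme \<Rightarrow> (nat \<Rightarrow> 'a) \<Rightarrow> 'a \<Rightarrow> bool" where
  "is_chain_sup L A s \<longleftrightarrow> is_chain L A \<and> is_lub L s (range A)"

definition pullback :: "('o, 'a, 'm) cat_scheme \<Rightarrow> 'a \<Rightarrow> 'a \<Rightarrow> 'a \<times> 'a" where
  "pullback C f g = (SOME (p, q). is_pullback C f g p q)"

definition inverse_image :: "('o, 'a, 'm) cat_scheme \<Rightarrow> 'a \<Rightarrow> 'a \<Rightarrow> 'a" where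
  "inverse_image C g m = fst (pullback C g m)"

definition image_mono :: "('o, 'a, 'm) cat_scheme \<Rightarrow> 'a \<Rightarrow> 'a" where
  "image_mono C f = (SOME m. is_mono C m \<and>
     (\<exists>e\<in>Hom C (Dom C f) (Dom C m). regular_epi C e \<and> m \<cdot>\<^bsub>C\<^esub> e = f))"

definition product :: "('o, 'a, 'm) cat_scheme \<Rightarrow> 'o \<Rightarrow> 'o \<Rightarrow> 'a \<times> 'a" where
  "product C X Y = (SOME (p, q). is_product C X Y p q)"

definition proj1 :: "('o, 'a, 'm) cat_scheme \<Rightarrow> 'o \<Rightarrow> 'a" where
  "proj1 C X = fst (product C X X)"

definition proj2 :: "('o, 'a, 'm) cat_scheme \<Rightarrow> 'o \<Rightarrow> 'a" where
  "proj2 C X = snd (product C X X)"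

definition square :: "('o, 'a, 'm) cat_scheme \<Rightarrow> 'o \<Rightarrow> 'o" where
  "square C X = Dom C (proj1 C X)"

text \<open>The arrow into \<open>X \<times> X\<close> with components \<open>f\<close> and \<open>g\<close>, where \<open>X\<close> is their common codomain.\<close>

definition pairing :: "('o, 'a, 'm) cat_scheme \<Rightarrow> 'a \<Rightarrow> 'a \<Rightarrow> 'a" where
  "pairing C f g = (THE u. u \<in> Hom C (Dom C f) (square C (Cod C f)) \<and>
     proj1 C (Cod C f) \<cdot>\<^bsub>C\<^esub> u = f \<and> proj2 C (Cod C f) \<cdot>\<^bsub>C\<^esub> u = g)"

definition square_map :: "('o, 'a, 'm) cat_scheme \<Rightarrow> 'a \<Rightarrow> 'a" where
  "square_map C f = pairing C (f \<cdot>\<^bsub>C\<^esub> proj1 C (Dom C f)) (f \<cdot>\<^bsub>C\<^esub> proj2 C (Dom C f))"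

definition relation_on :: "('o, 'a, 'm) cat_scheme \<Rightarrow> 'o \<Rightarrow> 'a \<Rightarrow> bool" where
  "relation_on C X R \<longleftrightarrow> X \<in> Obj C \<and> is_mono C R \<and> Cod C R = square C X"

definition diagonal :: "('o, 'a, 'm) cat_scheme \<Rightarrow> 'o \<Rightarrow> 'a" where
  "diagonal C X = pairing C (Ide C X) (Ide C X)"

definition rel_op :: "('o, 'a, 'm) cat_scheme \<Rightarrow> 'o \<Rightarrow> 'a \<Rightarrow> 'a" where
  "rel_op C X R = pairing C (proj2 C X \<cdot>\<^bsub>C\<^esub> R) (proj1 C X \<cdot>\<^bsub>C\<^esub> R)"

text \<open>\<open>rel_comp C X S R\<close> is \<open>S \<circ> R\<close> (first \<open>R\<close>, then \<open>S\<close>): the pullback consists of the pairs of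
  \<open>x R y\<close> and \<open>y S z\<close>, and is sent to \<open>(x, z)\<close>.\<close>

definition rel_comp :: "('o, 'a, 'm) cat_scheme \<Rightarrow> 'o \<Rightarrow> 'a \<Rightarrow> 'a \<Rightarrow> 'a" where
  "rel_comp C X S R =
     (case pullback C (proj2 C X \<cdot>\<^bsub>C\<^esub> R) (proj1 C X \<cdot>\<^bsub>C\<^esub> S) of (p, q) \<Rightarrow>
        image_mono C (pairing C ((proj1 C X \<cdot>\<^bsub>C\<^esub> R) \<cdot>\<^bsub>C\<^esub> p) ((proj2 C X \<cdot>\<^bsub>C\<^esub> S) \<cdot>\<^bsub>C\<^esub> q)))"

definition reflexive_rel :: "('o, 'a, 'm) cat_scheme \<Rightarrow> 'o \<Rightarrow> 'a \<Rightarrow> bool" where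
  "reflexive_rel C X R \<longleftrightarrow> relation_on C X R \<and> sub_le C (diagonal C X) R"

definition preorder_rel :: "('o, 'a, 'm) cat_scheme \<Rightarrow> 'o \<Rightarrow> 'a \<Rightarrow> bool" where
  "preorder_rel C X R \<longleftrightarrow> reflexive_rel C X R \<and> sub_le C (rel_comp C X R R) R"

definition equivalence_rel :: "('o, 'a, 'm) cat_scheme \<Rightarrow> 'o \<Rightarrow> 'a \<Rightarrow> bool" where
  "equivalence_rel C X R \<longleftrightarrow> preorder_rel C X R \<and> sub_le C (rel_op C X R) R"

definition ReflexiveRels :: "('o, 'a, 'm) cat_scheme \<Rightarrow> 'o \<Rightarrow> 'a gorder" where
  "ReflexiveRels C X = sub_order C {R. reflexive_rel C X R}"

definition PreorderRels :: "('o, 'a, 'm) cat_scheme \<Rightarrow> 'o \<Rightarrow> 'a gorder" where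
  "PreorderRels C X = sub_order C {R. preorder_rel C X R}"

definition EquivalenceRels :: "('o, 'a, 'm) cat_scheme \<Rightarrow> 'o \<Rightarrow> 'a gorder" where
  "EquivalenceRels C X = sub_order C {R. equivalence_rel C X R}"


section \<open>The categories of reflexive relations, preorders and equivalence relations\<close>

text \<open>An arrow \<open>((X, R), (Y, S), f)\<close> carries its domain and codomain along with the underlying
  arrow \<open>f\<close>.\<close>

definition Ref_cat ::
  "('o, 'a, 'm) cat_scheme \<Rightarrow> ('o \<times> 'a, ('o \<times> 'a) \<times> ('o \<times> 'a) \<times> 'a) cat" where
  "Ref_cat C =
     \<lparr>Obj = {(X, R). reflexive_rel C X R},
      Arr = {((X, R), (Y, S), f). reflexive_rel C X R \<and> reflexive_rel C Y S \<and>
               f \<in> Hom C X Y \<and> sub_le C R (inverse_image C (square_map C f) S)},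
      Dom = (\<lambda>(A, B, f). A),
      Cod = (\<lambda>(A, B, f). B),
      Ide = (\<lambda>A. (A, A, Ide C (fst A))),
      Comp = (\<lambda>(_, B', g) (A, _, f). (A, B', g \<cdot>\<^bsub>C\<^esub> f))\<rparr>"

definition PrO_cat ::
  "('o, 'a, 'm) cat_scheme \<Rightarrow> ('o \<times> 'a, ('o \<times> 'a) \<times> ('o \<times> 'a) \<times> 'a) cat" where
  "PrO_cat C = full_subcategory (Ref_cat C) {(X, R). preorder_rel C X R}"

definition Equ_cat ::
  "('o, 'a, 'm) cat_scheme \<Rightarrow> ('o \<times> 'a, ('o \<times> 'a) \<times> ('o \<times> 'a) \<times> 'a) cat" where
  "Equ_cat C = full_subcategory (Ref_cat C) {(X, R). equivalence_rel C X R}"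

definition ground_obj :: "'o \<times> 'a \<Rightarrow> 'o" where
  "ground_obj = fst"

definition ground_arr :: "('o \<times> 'a) \<times> ('o \<times> 'a) \<times> 'a \<Rightarrow> 'a" where
  "ground_arr = (\<lambda>(A, B, f). f)"

end

theory Submission
  imports Defs
begin

text \<open>The argument rests on one observation. Let \<open>T\<close> be a reflexive relation on \<open>X\<close> with legs
  \<open>d\<^sub>0\<close>, \<open>d\<^sub>1\<close>. The composite \<open>R T\<close> is obtained from \<open>R\<close> by taking the inverse image along
  \<open>d\<^sub>1 \<times> 1\<close>, from \<open>T \<times> X\<close> to \<open>X \<times> X\<close>, and then the direct image along \<open>d\<^sub>0 \<times> 1\<close>. Reflexivity
  makes \<open>d\<^sub>1\<close>, hence \<open>d\<^sub>1 \<times> 1\<close>, a split epimorphism, so the inverse image preserves suprema of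
  chains by hypothesis; the direct image is a left adjoint and preserves all suprema. The same works
  for \<open>T R\<close>, so composition of reflexive relations preserves suprema of chains in each variable
  (\<open>chain_sup_transfer\<close>, \<open>chain_sup_compose_right\<close>, \<open>chain_sup_compose_left\<close>). The suprema
  themselves are those of subobjects of \<open>X \<times> X\<close>, since a subobject above a reflexive relation is
  reflexive.

  It follows that every reflexive relation \<open>Q\<close> generates a preorder, the supremum of its iterated
  squares (\<open>generated_preorder\<close>). The join of two preorders \<open>R\<close>, \<open>S\<close> is generated by \<open>S R\<close>, and
  the codomain of the cocartesian map above a regular epimorphism \<open>f\<close> with domain \<open>R\<close> is generated
  by the direct image of \<open>R\<close> along \<open>f \<times> f\<close>, which is reflexive because \<open>f\<close> is a regular
  epimorphism. When the given relations are equivalence relations, the opposite of the generated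
  preorder satisfies the property that characterizes this preorder as the least one; hence it
  contains the generated preorder, which is therefore symmetric.

  Everything is computed with generalized elements: the pair \<open>(a, b)\<close> belongs to \<open>R\<close> when the arrow
  into \<open>X \<times> X\<close> with components \<open>a\<close>, \<open>b\<close> factors through \<open>R\<close>. Composites and direct images,
  which involve an image factorization, enter only through their universal properties
  (\<open>image_mono_le_iff\<close>, \<open>rel_comp_le_iff\<close>), so that no cover of the domain of an element has to be
  carried along.\<close>

section \<open>Arrows, monomorphisms and regular epimorphisms\<close>

lemma HomI: "f \<in> Arr C \<Longrightarrow> Dom C f = X \<Longrightarrow> Cod C f = Y \<Longrightarrow> f \<in> Hom C X Y"
  by (simp add: Hom_def)

lemma HomD:
  assumes "f \<in> Hom C X Y"
  shows "f \<in> Arr C" "Dom C f = X" "Cod C f = Y"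
  using assms by (simp_all add: Hom_def)

context category
begin

lemma Hom_Obj:
  assumes "f \<in> Hom C X Y"
  shows "X \<in> Obj C" "Y \<in> Obj C"
  using assms Dom_Obj Cod_Obj by (auto simp: Hom_def)

lemma mono_cancel:
  assumes "is_mono C m" "m \<in> Hom C A B" "f \<in> Hom C Z A" "g \<in> Hom C Z A" "m \<cdot> f = m \<cdot> g"
  shows "f = g"
  using assms unfolding is_mono_def Hom_def by auto

lemma monoI:
  assumes "m \<in> Hom C A B"
    and "\<And>Z f g. f \<in> Hom C Z A \<Longrightarrow> g \<in> Hom C Z A \<Longrightarrow> m \<cdot> f = m \<cdot> g \<Longrightarrow> f = g"
  shows "is_mono C m"
  unfolding is_mono_def using assms HomD[OF assms(1)] by (metis HomI)

lemma is_coequalizer_Hom: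
  assumes "is_coequalizer C f g e" "e \<in> Hom C X Y"
  shows "f \<in> Hom C (Dom C f) X" "g \<in> Hom C (Dom C f) X" "e \<cdot> f = e \<cdot> g"
  using assms unfolding is_coequalizer_def Hom_def by simp_all

lemma is_coequalizer_factor:
  assumes "is_coequalizer C f g e" "e \<in> Hom C X Y" "h \<in> Hom C X Z" "h \<cdot> f = h \<cdot> g"
  shows "\<exists>!u. u \<in> Hom C Y Z \<and> u \<cdot> e = h"
proof -
  have "h \<in> Arr C" "Dom C h = Cod C f" "Cod C h = Z" "Cod C e = Y"
    using assms unfolding is_coequalizer_def Hom_def by simp_all
  then show ?thesis
    using assms(1,4) unfolding is_coequalizer_def by blast
qed

lemma regular_epi_cancel:
  assumes e: "regular_epi C e" "e \<in> Hom C X Y" and u: "u \<in> Hom C Y Z" and v: "v \<in> Hom C Y Z"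
    and eq: "u \<cdot> e = v \<cdot> e"
  shows "u = v"
proof -
  from e obtain f g where fg: "is_coequalizer C f g e"
    unfolding regular_epi_def by blast
  note f = is_coequalizer_Hom(1)[OF fg e(2)] and g = is_coequalizer_Hom(2)[OF fg e(2)]
    and efg = is_coequalizer_Hom(3)[OF fg e(2)]
  have ue: "u \<cdot> e \<in> Hom C X Z"
    using Comp_Hom e(2) u by blast
  have "(u \<cdot> e) \<cdot> f = (u \<cdot> e) \<cdot> g"
    using Comp_assoc[OF f e(2) u] Comp_assoc[OF g e(2) u] efg by simp
  then show ?thesis
    using is_coequalizer_factor[OF fg e(2) ue] u v eq by metis
qed

text \<open>For an arbitrary arrow \<open>u\<close>, not only for a mono, \<open>sub_le C u m\<close> says that \<open>u\<close> factors through
  \<open>m\<close>, that is, that the generalized element \<open>u\<close> belongs to the subobject \<open>m\<close>. This reading is used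
  throughout: a subobject is handled through the generalized elements that belong to it.\<close>

lemma sub_leI: "h \<in> Hom C Z A \<Longrightarrow> m \<in> Hom C A X \<Longrightarrow> sub_le C (m \<cdot> h) m"
  unfolding sub_le_def using Comp_Hom[of h Z A m X] by (auto simp: Hom_def)

lemma sub_leE:
  assumes "sub_le C u m" "u \<in> Hom C Z X" "m \<in> Hom C A X"
  obtains h where "h \<in> Hom C Z A" "m \<cdot> h = u"
  using assms by (auto simp: sub_le_def Hom_def)

lemma sub_le_refl: "m \<in> Arr C \<Longrightarrow> sub_le C m m"
  using Ide_Hom[OF Dom_Obj, of m] Comp_Ide[of m "Dom C m" "Cod C m"]
  unfolding sub_le_def by (auto simp: Hom_def)

lemma sub_le_trans:
  assumes "sub_le C u m" "sub_le C m n" "n \<in> Arr C"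
  shows "sub_le C u n"
proof -
  obtain h k where h: "h \<in> Hom C (Dom C u) (Dom C m)" "m \<cdot> h = u"
    and k: "k \<in> Hom C (Dom C m) (Dom C n)" "n \<cdot> k = m"
    using assms unfolding sub_le_def by blast
  have "n \<cdot> (k \<cdot> h) = u"
    using Comp_assoc[OF h(1) k(1), of n "Cod C n"] assms(3) h k by (simp add: Hom_def)
  then show ?thesis
    unfolding sub_le_def using Comp_Hom[OF h(1) k(1)] by blast
qed

lemma sub_le_comp:
  assumes "sub_le C u m" "u \<in> Hom C Z X" "m \<in> Hom C A X" "k \<in> Hom C Z' Z"
  shows "sub_le C (u \<cdot> k) m"
proof -
  obtain h where h: "h \<in> Hom C Z A" "m \<cdot> h = u"
    using assms by (blast elim: sub_leE)
  have "u \<cdot> k = m \<cdot> (h \<cdot> k)"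
    using Comp_assoc[OF assms(4) h(1) assms(3)] h by simp
  then show ?thesis
    using sub_leI[OF Comp_Hom[OF assms(4) h(1)] assms(3)] by simp
qed

text \<open>Regular epimorphisms are orthogonal to monos: membership in a subobject can be tested after
  covering the domain of the element by a regular epimorphism.\<close>

lemma sub_le_of_regular_epi:
  assumes e: "regular_epi C e" "e \<in> Hom C Z' Z" and x: "x \<in> Hom C Z X"
    and m: "is_mono C m" "m \<in> Hom C A X" and le: "sub_le C (x \<cdot> e) m"
  shows "sub_le C x m"
proof -
  have xe: "x \<cdot> e \<in> Hom C Z' X"
    using Comp_Hom e x by blast
  obtain h where h: "h \<in> Hom C Z' A" "m \<cdot> h = x \<cdot> e"
    using sub_leE[OF le xe m(2)] by blast
  from e obtain f g where fg: "is_coequalizer C f g e"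
    unfolding regular_epi_def by blast
  note f = is_coequalizer_Hom(1)[OF fg e(2)] and g = is_coequalizer_Hom(2)[OF fg e(2)]
    and efg = is_coequalizer_Hom(3)[OF fg e(2)]
  have "m \<cdot> (h \<cdot> f) = m \<cdot> (h \<cdot> g)"
    using Comp_assoc[OF f h(1) m(2)] Comp_assoc[OF g h(1) m(2)]
      Comp_assoc[OF f e(2) x] Comp_assoc[OF g e(2) x] h(2) efg by simp
  then have "h \<cdot> f = h \<cdot> g"
    using mono_cancel[OF m Comp_Hom[OF f h(1)] Comp_Hom[OF g h(1)]] by simp
  then obtain k where k: "k \<in> Hom C Z A" "k \<cdot> e = h"
    using is_coequalizer_factor[OF fg e(2) h(1)] by blast
  have "(m \<cdot> k) \<cdot> e = x \<cdot> e"
    using Comp_assoc[OF e(2) k(1) m(2)] k h by simp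
  then have "m \<cdot> k = x"
    using regular_epi_cancel[OF e Comp_Hom[OF k(1) m(2)] x] by simp
  then show ?thesis
    using sub_leI[OF k(1) m(2)] by simp
qed

lemma is_pullback_Hom:
  assumes "is_pullback C f g p q" "f \<in> Hom C X W" "g \<in> Hom C Y W"
  shows "p \<in> Hom C (Dom C p) X" "q \<in> Hom C (Dom C p) Y" "f \<cdot> p = g \<cdot> q"
  using assms unfolding is_pullback_def Hom_def by auto

lemma is_pullback_universal:
  assumes "is_pullback C f g p q" "f \<in> Hom C X W" "g \<in> Hom C Y W"
    and "h \<in> Hom C Z X" "k \<in> Hom C Z Y" "f \<cdot> h = g \<cdot> k"
  shows "\<exists>!u. u \<in> Hom C Z (Dom C p) \<and> p \<cdot> u = h \<and> q \<cdot> u = k"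
proof -
  have "h \<in> Hom C Z (Dom C f)" "k \<in> Hom C Z (Dom C g)"
    using assms HomD(2) by metis+
  then show ?thesis
    using assms(1,6) unfolding is_pullback_def by blast
qed

lemma is_pullback_lift:
  assumes "is_pullback C f g p q" "f \<in> Hom C X W" "g \<in> Hom C Y W"
    and "h \<in> Hom C Z X" "k \<in> Hom C Z Y" "f \<cdot> h = g \<cdot> k"
  obtains u where "u \<in> Hom C Z (Dom C p)" "p \<cdot> u = h" "q \<cdot> u = k"
  using is_pullback_universal[OF assms] by blast

lemma is_pullback_eqI:
  assumes pb: "is_pullback C f g p q" and f: "f \<in> Hom C X W" and g: "g \<in> Hom C Y W"
    and u: "u \<in> Hom C Z (Dom C p)" and v: "v \<in> Hom C Z (Dom C p)"
    and eq: "p \<cdot> u = p \<cdot> v" "q \<cdot> u = q \<cdot> v"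
  shows "u = v"
proof -
  note p = is_pullback_Hom[OF pb f g]
  have "f \<cdot> (p \<cdot> u) = g \<cdot> (q \<cdot> u)"
    using Comp_assoc[OF u p(1) f] Comp_assoc[OF u p(2) g] p(3) by simp
  then show ?thesis
    using is_pullback_universal[OF pb f g Comp_Hom[OF u p(1)] Comp_Hom[OF u p(2)]] u v eq by metis
qed

end

context regular_category
begin

lemma pullback_is_pullback:
  assumes "f \<in> Hom C X W" "g \<in> Hom C Y W"
  shows "is_pullback C f g (fst (pullback C f g)) (snd (pullback C f g))"
proof -
  obtain p q where "is_pullback C f g p q"
    using has_pullbacks[of f g] assms by (auto simp: Hom_def)
  then have "case (p, q) of (p, q) \<Rightarrow> is_pullback C f g p q"
    by simp
  then have "case pullback C f g of (p, q) \<Rightarrow> is_pullback C f g p q"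
    unfolding pullback_def by (rule someI)
  then show ?thesis
    by (simp add: case_prod_beta)
qed

lemma inverse_image_mono:
  assumes g: "g \<in> Hom C Z X" and m: "is_mono C m" "m \<in> Hom C A X"
  shows "is_mono C (inverse_image C g m)"
    and "inverse_image C g m \<in> Hom C (Dom C (inverse_image C g m)) Z"
proof -
  define p where "p = fst (pullback C g m)"
  define q where "q = snd (pullback C g m)"
  have pb: "is_pullback C g m p q"
    unfolding p_def q_def by (rule pullback_is_pullback[OF g m(2)])
  note pq = is_pullback_Hom[OF pb g m(2)]
  have "is_mono C p"
  proof (rule monoI[OF pq(1)])
    fix V u v
    assume u: "u \<in> Hom C V (Dom C p)" and v: "v \<in> Hom C V (Dom C p)" and eq: "p \<cdot> u = p \<cdot> v"
    have "m \<cdot> (q \<cdot> u) = m \<cdot> (q \<cdot> v)"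
      using Comp_assoc[OF u pq(2) m(2)] Comp_assoc[OF v pq(2) m(2)] pq(3) eq
        Comp_assoc[OF u pq(1) g] Comp_assoc[OF v pq(1) g] by simp
    then have "q \<cdot> u = q \<cdot> v"
      using mono_cancel[OF m Comp_Hom[OF u pq(2)] Comp_Hom[OF v pq(2)]] by simp
    then show "u = v"
      using is_pullback_eqI[OF pb g m(2) u v eq] by simp
  qed
  then show "is_mono C (inverse_image C g m)"
    and "inverse_image C g m \<in> Hom C (Dom C (inverse_image C g m)) Z"
    using pq(1) by (simp_all add: inverse_image_def p_def)
qed

lemma sub_le_inverse_image_iff:
  assumes g: "g \<in> Hom C Z X" and m: "m \<in> Hom C A X" and u: "u \<in> Hom C V Z"
  shows "sub_le C u (inverse_image C g m) \<longleftrightarrow> sub_le C (g \<cdot> u) m"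
proof -
  define p where "p = fst (pullback C g m)"
  define q where "q = snd (pullback C g m)"
  have pb: "is_pullback C g m p q"
    unfolding p_def q_def by (rule pullback_is_pullback[OF g m])
  note pq = is_pullback_Hom[OF pb g m]
  have "sub_le C u p \<longleftrightarrow> sub_le C (g \<cdot> u) m"
  proof
    assume "sub_le C u p"
    then obtain h where h: "h \<in> Hom C V (Dom C p)" "p \<cdot> h = u"
      using sub_leE[OF _ u pq(1)] by blast
    have "g \<cdot> u = m \<cdot> (q \<cdot> h)"
      using Comp_assoc[OF h(1) pq(1) g] Comp_assoc[OF h(1) pq(2) m] pq(3) h(2) by simp
    then show "sub_le C (g \<cdot> u) m"
      using sub_leI[OF Comp_Hom[OF h(1) pq(2)] m] by simp
  next
    assume "sub_le C (g \<cdot> u) m"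
    then obtain k where k: "k \<in> Hom C V A" "m \<cdot> k = g \<cdot> u"
      using sub_leE[OF _ Comp_Hom[OF u g] m] by blast
    then obtain h where "h \<in> Hom C V (Dom C p)" "p \<cdot> h = u"
      using is_pullback_lift[OF pb g m u k(1)] by metis
    then show "sub_le C u p"
      using sub_leI[OF _ pq(1)] by metis
  qed
  then show ?thesis
    by (simp add: inverse_image_def p_def)
qed

text \<open>The coequalizer \<open>e\<close> of the kernel pair of \<open>f\<close> leaves a mono \<open>m\<close> with \<open>m \<cdot> e = f\<close>: two
  elements \<open>u\<close>, \<open>v\<close> identified by \<open>m\<close> lift, after covering their domain by regular epimorphisms
  obtained by pulling back \<open>e\<close>, to elements of the domain of \<open>f\<close> identified by \<open>f\<close>, hence to
  elements identified by \<open>e\<close>.\<close>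

lemma regular_epi_mono_factorization:
  assumes f: "f \<in> Hom C X Y"
  shows "\<exists>m. is_mono C m \<and> (\<exists>e\<in>Hom C X (Dom C m). regular_epi C e \<and> m \<cdot> e = f)"
proof -
  obtain p q where pb: "is_pullback C f f p q"
    using has_pullbacks[of f f] f by (auto simp: Hom_def)
  note pq = is_pullback_Hom[OF pb f f]
  obtain e where co: "is_coequalizer C p q e"
    using kernel_pair_coequalizer[OF pb] by blast
  define I where "I = Cod C e"
  have "regular_epi C e"
    using co unfolding regular_epi_def by blast
  moreover have "e \<in> Hom C X I"
    using co HomD[OF pq(1)] unfolding is_coequalizer_def I_def Hom_def by simp
  ultimately have e: "regular_epi C e" "e \<in> Hom C X I"
    by simp_all
  note epq = is_coequalizer_Hom(3)[OF co e(2)]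
  obtain m where m: "m \<in> Hom C I Y" "m \<cdot> e = f"
    using is_coequalizer_factor[OF co e(2) f pq(3)] by blast
  have "is_mono C m"
  proof (rule monoI[OF m(1)])
    fix Z u v
    assume u: "u \<in> Hom C Z I" and v: "v \<in> Hom C Z I" and eq: "m \<cdot> u = m \<cdot> v"
    obtain z a where pb1: "is_pullback C u e z a"
      using has_pullbacks[of u e] u e by (auto simp: Hom_def)
    note za = is_pullback_Hom[OF pb1 u e(2)]
    define Z1 where "Z1 = Dom C z"
    have z: "z \<in> Hom C Z1 Z" "regular_epi C z" and a: "a \<in> Hom C Z1 X"
      using za regular_epi_stable[OF e(1) pb1] by (simp_all add: Z1_def)
    have vz: "v \<cdot> z \<in> Hom C Z1 I"
      using Comp_Hom[OF z(1) v] .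
    obtain y b where pb2: "is_pullback C (v \<cdot> z) e y b"
      using has_pullbacks[of "v \<cdot> z" e] vz e by (auto simp: Hom_def)
    note yb = is_pullback_Hom[OF pb2 vz e(2)]
    define Z2 where "Z2 = Dom C y"
    have y: "y \<in> Hom C Z2 Z1" "regular_epi C y" and b: "b \<in> Hom C Z2 X"
      using yb regular_epi_stable[OF e(1) pb2] by (simp_all add: Z2_def)
    have ay: "a \<cdot> y \<in> Hom C Z2 X"
      using Comp_Hom[OF y(1) a] .
    have uz: "u \<cdot> z \<in> Hom C Z1 I"
      using Comp_Hom[OF z(1) u] .
    have eay: "e \<cdot> (a \<cdot> y) = (u \<cdot> z) \<cdot> y"
      using Comp_assoc[OF y(1) a e(2)] za(3) by simp
    have "f \<cdot> (a \<cdot> y) = m \<cdot> ((u \<cdot> z) \<cdot> y)"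
      using Comp_assoc[OF ay e(2) m(1)] m(2) eay by simp
    also have "\<dots> = (m \<cdot> (u \<cdot> z)) \<cdot> y"
      using Comp_assoc[OF y(1) uz m(1)] by simp
    also have "m \<cdot> (u \<cdot> z) = m \<cdot> (v \<cdot> z)"
      using Comp_assoc[OF z(1) u m(1)] Comp_assoc[OF z(1) v m(1)] eq by simp
    also have "(m \<cdot> (v \<cdot> z)) \<cdot> y = m \<cdot> (e \<cdot> b)"
      using Comp_assoc[OF y(1) vz m(1)] yb(3) by simp
    also have "\<dots> = f \<cdot> b"
      using Comp_assoc[OF b e(2) m(1)] m(2) by simp
    finally obtain w where w: "w \<in> Hom C Z2 (Dom C p)" "p \<cdot> w = a \<cdot> y" "q \<cdot> w = b"
      using is_pullback_lift[OF pb f f ay b] by metis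
    have "e \<cdot> (a \<cdot> y) = e \<cdot> b"
      using Comp_assoc[OF w(1) pq(1) e(2)] Comp_assoc[OF w(1) pq(2) e(2)] w epq by simp
    then have "(u \<cdot> z) \<cdot> y = (v \<cdot> z) \<cdot> y"
      using eay yb(3) by simp
    then have "u \<cdot> z = v \<cdot> z"
      using regular_epi_cancel[OF y(2,1) uz vz] by simp
    then show "u = v"
      using regular_epi_cancel[OF z(2,1) u v] by simp
  qed
  then show ?thesis
    using e m HomD[OF m(1)] by metis
qed

lemma image_mono_factorization:
  assumes f: "f \<in> Hom C X Y"
  obtains e where "is_mono C (image_mono C f)"
    "image_mono C f \<in> Hom C (Dom C (image_mono C f)) Y"
    "e \<in> Hom C X (Dom C (image_mono C f))" "regular_epi C e" "image_mono C f \<cdot> e = f"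
proof -
  let ?m = "image_mono C f"
  have "is_mono C ?m \<and> (\<exists>e\<in>Hom C X (Dom C ?m). regular_epi C e \<and> ?m \<cdot> e = f)"
    using someI_ex[OF regular_epi_mono_factorization[OF f]] HomD[OF f]
    unfolding image_mono_def by simp
  then obtain e where e: "is_mono C ?m" "e \<in> Hom C X (Dom C ?m)" "regular_epi C e" "?m \<cdot> e = f"
    by blast
  then have m: "?m \<in> Hom C (Dom C ?m) (Cod C ?m)"
    by (simp add: is_mono_def Hom_def)
  then have "Cod C ?m = Y"
    using Comp_Hom[OF e(2) m] e(4) HomD[OF f] by (simp add: Hom_def)
  then show ?thesis
    using that e m by simp
qed

lemma image_mono_is_mono:
  assumes "f \<in> Hom C X Y"
  shows "is_mono C (image_mono C f)" "image_mono C f \<in> Hom C (Dom C (image_mono C f)) Y"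
  using image_mono_factorization[OF assms] by metis+

lemma sub_le_image_mono_self:
  assumes "f \<in> Hom C X Y"
  shows "sub_le C f (image_mono C f)"
  using image_mono_factorization[OF assms] sub_leI by metis

lemma image_mono_le_iff:
  assumes f: "f \<in> Hom C X Y" and n: "is_mono C n" "n \<in> Hom C B Y"
  shows "sub_le C (image_mono C f) n \<longleftrightarrow> sub_le C f n"
proof
  assume "sub_le C (image_mono C f) n"
  then show "sub_le C f n"
    using sub_le_trans[OF sub_le_image_mono_self[OF f]] HomD(1)[OF n(2)] by blast
next
  assume le: "sub_le C f n"
  obtain e where e: "image_mono C f \<in> Hom C (Dom C (image_mono C f)) Y"
    "e \<in> Hom C X (Dom C (image_mono C f))" "regular_epi C e" "image_mono C f \<cdot> e = f"
    using image_mono_factorization[OF f] by metis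
  show "sub_le C (image_mono C f) n"
    using sub_le_of_regular_epi[OF e(3,2,1) n] e(4) le by simp
qed


section \<open>Products and relations\<close>

lemma product_exists:
  assumes X: "X \<in> Obj C" and Y: "Y \<in> Obj C"
  shows "\<exists>p q. is_product C X Y p q"
proof -
  obtain T where T: "is_terminal C T"
    using has_terminal by blast
  obtain x y where x: "x \<in> Hom C X T" and y: "y \<in> Hom C Y T"
    using T X Y unfolding is_terminal_def by metis
  obtain p q where pb: "is_pullback C x y p q"
    using has_pullbacks[of x y] x y by (auto simp: Hom_def)
  note pq = is_pullback_Hom[OF pb x y]
  have "\<exists>!u. u \<in> Hom C Z (Dom C p) \<and> p \<cdot> u = f \<and> q \<cdot> u = g"
    if f: "f \<in> Hom C Z X" and g: "g \<in> Hom C Z Y" for Z f g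
  proof -
    have "x \<cdot> f = y \<cdot> g"
      using T Comp_Hom[OF f x] Comp_Hom[OF g y] Hom_Obj(1)[OF f] unfolding is_terminal_def by metis
    then show ?thesis
      using is_pullback_universal[OF pb x y f g] by blast
  qed
  then have "is_product C X Y p q"
    unfolding is_product_def using HomD[OF pq(1)] HomD[OF pq(2)] by auto
  then show ?thesis
    by blast
qed

lemma product_is_product:
  assumes "X \<in> Obj C" "Y \<in> Obj C"
  shows "is_product C X Y (fst (product C X Y)) (snd (product C X Y))"
proof -
  obtain p q where "is_product C X Y p q"
    using product_exists[OF assms] by blast
  then have "case (p, q) of (p, q) \<Rightarrow> is_product C X Y p q"
    by simp
  then have "case product C X Y of (p, q) \<Rightarrow> is_product C X Y p q"
    unfolding product_def by (rule someI)
  then show ?thesis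
    by (simp add: case_prod_beta)
qed

lemma square_is_product:
  assumes "X \<in> Obj C"
  shows "is_product C X X (proj1 C X) (proj2 C X)"
  unfolding proj1_def proj2_def by (rule product_is_product[OF assms assms])

lemma proj_Hom:
  assumes "X \<in> Obj C"
  shows "proj1 C X \<in> Hom C (square C X) X" "proj2 C X \<in> Hom C (square C X) X"
  using square_is_product[OF assms] unfolding is_product_def square_def Hom_def by auto

lemma square_Obj: "X \<in> Obj C \<Longrightarrow> square C X \<in> Obj C"
  using proj_Hom Hom_Obj by blast

lemma pairing_Hom:
  assumes a: "a \<in> Hom C Z X" and b: "b \<in> Hom C Z X"
  shows "pairing C a b \<in> Hom C Z (square C X)"
    and "proj1 C X \<cdot> pairing C a b = a" "proj2 C X \<cdot> pairing C a b = b"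
proof -
  have "\<exists>!u. u \<in> Hom C Z (square C X) \<and> proj1 C X \<cdot> u = a \<and> proj2 C X \<cdot> u = b"
    using square_is_product[OF Hom_Obj(2)[OF a]] a b unfolding is_product_def square_def by blast
  from theI'[OF this] have "pairing C a b \<in> Hom C Z (square C X) \<and>
      proj1 C X \<cdot> pairing C a b = a \<and> proj2 C X \<cdot> pairing C a b = b"
    unfolding pairing_def HomD(2,3)[OF a] .
  then show "pairing C a b \<in> Hom C Z (square C X)"
    and "proj1 C X \<cdot> pairing C a b = a" "proj2 C X \<cdot> pairing C a b = b"
    by auto
qed

lemma square_eqI:
  assumes X: "X \<in> Obj C" and u: "u \<in> Hom C Z (square C X)" and v: "v \<in> Hom C Z (square C X)"
    and "proj1 C X \<cdot> u = proj1 C X \<cdot> v" "proj2 C X \<cdot> u = proj2 C X \<cdot> v"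
  shows "u = v"
proof -
  have "\<exists>!w. w \<in> Hom C Z (square C X) \<and> proj1 C X \<cdot> w = proj1 C X \<cdot> v \<and>
      proj2 C X \<cdot> w = proj2 C X \<cdot> v"
    using square_is_product[OF X] Comp_Hom[OF v] proj_Hom[OF X]
    unfolding is_product_def square_def by blast
  then show ?thesis
    using assms by metis
qed

lemma pairing_proj:
  assumes X: "X \<in> Obj C" and u: "u \<in> Hom C Z (square C X)"
  shows "pairing C (proj1 C X \<cdot> u) (proj2 C X \<cdot> u) = u"
  using square_eqI[OF X _ u] pairing_Hom Comp_Hom[OF u] proj_Hom[OF X] by metis

lemma pairing_comp:
  assumes a: "a \<in> Hom C Z X" and b: "b \<in> Hom C Z X" and k: "k \<in> Hom C V Z"
  shows "pairing C a b \<cdot> k = pairing C (a \<cdot> k) (b \<cdot> k)"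
proof -
  note X = Hom_Obj(2)[OF a]
  note ab = pairing_Hom[OF a b]
  have abk: "pairing C a b \<cdot> k \<in> Hom C V (square C X)"
    using Comp_Hom[OF k ab(1)] .
  show ?thesis
    using pairing_proj[OF X abk] Comp_assoc[OF k ab(1) proj_Hom(1)[OF X]]
      Comp_assoc[OF k ab(1) proj_Hom(2)[OF X]] ab by simp
qed

abbreviation related :: "'b \<Rightarrow> 'b \<Rightarrow> 'b \<Rightarrow> bool" where
  "related R a b \<equiv> sub_le C (pairing C a b) R"

lemma relation_onD:
  assumes "relation_on C X R"
  shows "X \<in> Obj C" "is_mono C R" "R \<in> Hom C (Dom C R) (square C X)"
  using assms by (auto simp: relation_on_def is_mono_def Hom_def)

lemma relation_onI:
  "X \<in> Obj C \<Longrightarrow> is_mono C R \<Longrightarrow> R \<in> Hom C A (square C X) \<Longrightarrow> relation_on C X R"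
  by (auto simp: relation_on_def Hom_def)

lemma relation_legs_Hom:
  assumes "relation_on C X R"
  shows "proj1 C X \<cdot> R \<in> Hom C (Dom C R) X" "proj2 C X \<cdot> R \<in> Hom C (Dom C R) X"
  using Comp_Hom relation_onD[OF assms] proj_Hom by blast+

lemma related_legs:
  assumes "relation_on C X R"
  shows "related R (proj1 C X \<cdot> R) (proj2 C X \<cdot> R)"
  using pairing_proj[OF relation_onD(1,3)[OF assms]] sub_le_refl
    HomD(1)[OF relation_onD(3)[OF assms]] by simp

lemma relatedE:
  assumes R: "relation_on C X R" and a: "a \<in> Hom C Z X" and b: "b \<in> Hom C Z X"
    and rel: "related R a b"
  obtains h where "h \<in> Hom C Z (Dom C R)" "(proj1 C X \<cdot> R) \<cdot> h = a" "(proj2 C X \<cdot> R) \<cdot> h = b"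
proof -
  note R' = relation_onD[OF R]
  note ab = pairing_Hom[OF a b]
  obtain h where h: "h \<in> Hom C Z (Dom C R)" "R \<cdot> h = pairing C a b"
    using sub_leE[OF rel ab(1) R'(3)] by blast
  show ?thesis
    using that[OF h(1)] Comp_assoc[OF h(1) R'(3) proj_Hom(1)[OF R'(1)]]
      Comp_assoc[OF h(1) R'(3) proj_Hom(2)[OF R'(1)]] h(2) ab by simp
qed

lemma related_comp:
  assumes "relation_on C X R" "a \<in> Hom C Z X" "b \<in> Hom C Z X" "related R a b" "k \<in> Hom C V Z"
  shows "related R (a \<cdot> k) (b \<cdot> k)"
  using sub_le_comp[OF assms(4) pairing_Hom(1)[OF assms(2,3)] relation_onD(3)[OF assms(1)] assms(5)]
    pairing_comp[OF assms(2,3,5)] by simp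

lemma related_mono:
  assumes "related R a b" "sub_le C R S" "relation_on C X S"
  shows "related S a b"
  using sub_le_trans[OF assms(1,2)] HomD(1)[OF relation_onD(3)[OF assms(3)]] by blast

lemma relation_leI:
  assumes R: "relation_on C X R"
    and le: "\<And>Z a b. a \<in> Hom C Z X \<Longrightarrow> b \<in> Hom C Z X \<Longrightarrow> related R a b \<Longrightarrow> related S a b"
  shows "sub_le C R S"
  using le[OF relation_legs_Hom[OF R] related_legs[OF R]]
    pairing_proj[OF relation_onD(1,3)[OF R]] by simp

lemma relation_le_trans:
  "sub_le C R S \<Longrightarrow> sub_le C S T \<Longrightarrow> relation_on C X T \<Longrightarrow> sub_le C R T"
  using sub_le_trans HomD(1)[OF relation_onD(3)] by blast

lemma diagonal_le_iff:
  assumes R: "relation_on C X R"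
  shows "sub_le C (diagonal C X) R \<longleftrightarrow> (\<forall>Z. \<forall>a\<in>Hom C Z X. related R a a)"
proof -
  note i = Ide_Hom[OF relation_onD(1)[OF R]]
  have "related R a a" if "sub_le C (diagonal C X) R" and a: "a \<in> Hom C Z X" for Z a
    using related_comp[OF R i i _ a] that Ide_Comp[OF a] by (simp add: diagonal_def)
  then show ?thesis
    using i by (auto simp: diagonal_def)
qed

lemma rel_op_relation:
  assumes R: "relation_on C X R"
  shows "relation_on C X (rel_op C X R)"
proof -
  note R' = relation_onD[OF R]
  note l = relation_legs_Hom[OF R]
  note o = pairing_Hom[OF l(2,1)]
  have "is_mono C (rel_op C X R)"
    unfolding rel_op_def
  proof (rule monoI[OF o(1)])
    fix Z f g
    assume f: "f \<in> Hom C Z (Dom C R)" and g: "g \<in> Hom C Z (Dom C R)"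
      and eq: "pairing C (proj2 C X \<cdot> R) (proj1 C X \<cdot> R) \<cdot> f =
        pairing C (proj2 C X \<cdot> R) (proj1 C X \<cdot> R) \<cdot> g"
    have "(proj1 C X \<cdot> R) \<cdot> f = (proj1 C X \<cdot> R) \<cdot> g" "(proj2 C X \<cdot> R) \<cdot> f = (proj2 C X \<cdot> R) \<cdot> g"
      using pairing_Hom(2,3)[OF Comp_Hom[OF f l(2)] Comp_Hom[OF f l(1)]]
        pairing_Hom(2,3)[OF Comp_Hom[OF g l(2)] Comp_Hom[OF g l(1)]]
        pairing_comp[OF l(2,1) f] pairing_comp[OF l(2,1) g] eq by simp_all
    then have "R \<cdot> f = R \<cdot> g"
      using square_eqI[OF R'(1) Comp_Hom[OF f R'(3)] Comp_Hom[OF g R'(3)]]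
        Comp_assoc[OF f R'(3)] Comp_assoc[OF g R'(3)] proj_Hom[OF R'(1)] by metis
    then show "f = g"
      using mono_cancel[OF R'(2,3) f g] by simp
  qed
  then show ?thesis
    using relation_onI[OF R'(1) _ o(1)] by (simp add: rel_op_def)
qed

lemma related_rel_op_iff:
  assumes R: "relation_on C X R" and a: "a \<in> Hom C Z X" and b: "b \<in> Hom C Z X"
  shows "related (rel_op C X R) a b \<longleftrightarrow> related R b a"
proof -
  note l = relation_legs_Hom[OF R]
  note o = rel_op_relation[OF R]
  note po = pairing_Hom[OF l(2,1)]
  have d: "Dom C (rel_op C X R) = Dom C R"
    using HomD(2)[OF po(1)] by (simp add: rel_op_def)
  have legs: "proj1 C X \<cdot> rel_op C X R = proj2 C X \<cdot> R" "proj2 C X \<cdot> rel_op C X R = proj1 C X \<cdot> R"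
    using po by (simp_all add: rel_op_def)
  show ?thesis
  proof
    assume "related (rel_op C X R) a b"
    then obtain h where h: "h \<in> Hom C Z (Dom C R)" "(proj2 C X \<cdot> R) \<cdot> h = a" "(proj1 C X \<cdot> R) \<cdot> h = b"
      using relatedE[OF o a b] d legs by metis
    show "related R b a"
      using related_comp[OF R l related_legs[OF R] h(1)] h by simp
  next
    assume "related R b a"
    then obtain h where h: "h \<in> Hom C Z (Dom C R)" "(proj1 C X \<cdot> R) \<cdot> h = b" "(proj2 C X \<cdot> R) \<cdot> h = a"
      using relatedE[OF R b a] by metis
    show "related (rel_op C X R) a b"
      using related_comp[OF o, of "proj2 C X \<cdot> R" "Dom C R" "proj1 C X \<cdot> R" h Z] related_legs[OF o]
        legs l h by simp
  qed
qed

lemma rel_op_le_iff: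
  assumes R: "relation_on C X R" and S: "relation_on C X S"
  shows "sub_le C (rel_op C X R) S \<longleftrightarrow>
    (\<forall>Z. \<forall>a\<in>Hom C Z X. \<forall>b\<in>Hom C Z X. related R a b \<longrightarrow> related S b a)" (is "?L \<longleftrightarrow> ?R")
proof
  show ?R if ?L
    using related_rel_op_iff[OF R] related_mono[OF _ that S] by blast
  show ?L if ?R
    using that related_rel_op_iff[OF R] by (intro relation_leI[OF rel_op_relation[OF R]]) blast
qed

text \<open>An element \<open>(a, c)\<close> of the composite has an intermediate \<open>b\<close> only after its domain is covered
  by a regular epimorphism. As a map out of the composite, however, an inequality with a subobject
  \<open>W\<close> needs to be tested only on the pullback of pairs \<open>a R b\<close>, \<open>b S c\<close> whose image the
  composite is, and there the intermediate element is given.\<close>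

lemma rel_comp_universal:
  assumes R: "relation_on C X R" and S: "relation_on C X S"
  shows rel_comp_relation: "relation_on C X (rel_comp C X S R)"
    and rel_comp_le_iff: "\<And>W. relation_on C X W \<Longrightarrow> sub_le C (rel_comp C X S R) W \<longleftrightarrow>
      (\<forall>Z. \<forall>a\<in>Hom C Z X. \<forall>b\<in>Hom C Z X. \<forall>c\<in>Hom C Z X.
        related R a b \<longrightarrow> related S b c \<longrightarrow> related W a c)"
proof -
  note X = relation_onD(1)[OF R]
  note r = relation_legs_Hom[OF R]
  note s = relation_legs_Hom[OF S]
  let ?r1 = "proj1 C X \<cdot> R" and ?r2 = "proj2 C X \<cdot> R"
  let ?s1 = "proj1 C X \<cdot> S" and ?s2 = "proj2 C X \<cdot> S"
  define p where "p = fst (pullback C ?r2 ?s1)"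
  define q where "q = snd (pullback C ?r2 ?s1)"
  have pb: "is_pullback C ?r2 ?s1 p q"
    unfolding p_def q_def by (rule pullback_is_pullback[OF r(2) s(1)])
  note pq = is_pullback_Hom[OF pb r(2) s(1)]
  let ?x = "?r1 \<cdot> p" and ?z = "?s2 \<cdot> q"
  have x: "?x \<in> Hom C (Dom C p) X" and z: "?z \<in> Hom C (Dom C p) X"
    using Comp_Hom pq r s by blast+
  note xz = pairing_Hom[OF x z]
  have comp: "rel_comp C X S R = image_mono C (pairing C ?x ?z)"
    by (simp add: rel_comp_def case_prod_beta p_def q_def)
  show "relation_on C X (rel_comp C X S R)"
    unfolding comp using relation_onI[OF X] image_mono_is_mono[OF xz(1)] by blast
  fix W
  assume W: "relation_on C X W"
  have "sub_le C (rel_comp C X S R) W \<longleftrightarrow> related W ?x ?z"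
    unfolding comp by (rule image_mono_le_iff[OF xz(1) relation_onD(2,3)[OF W]])
  also have "\<dots> \<longleftrightarrow> (\<forall>Z. \<forall>a\<in>Hom C Z X. \<forall>b\<in>Hom C Z X. \<forall>c\<in>Hom C Z X.
      related R a b \<longrightarrow> related S b c \<longrightarrow> related W a c)" (is "_ \<longleftrightarrow> ?all")
  proof
    assume ?all
    moreover have "related R ?x (?r2 \<cdot> p)"
      using related_comp[OF R r related_legs[OF R] pq(1)] .
    moreover have "related S (?r2 \<cdot> p) ?z"
      using related_comp[OF S s related_legs[OF S] pq(2)] pq(3) by simp
    ultimately show "related W ?x ?z"
      using x z Comp_Hom[OF pq(1) r(2)] by blast
  next
    assume W': "related W ?x ?z"
    show ?all
    proof (intro allI ballI impI)
      fix Z a b c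
      assume a: "a \<in> Hom C Z X" and b: "b \<in> Hom C Z X" and c: "c \<in> Hom C Z X"
        and ab: "related R a b" and bc: "related S b c"
      obtain h where h: "h \<in> Hom C Z (Dom C R)" "?r1 \<cdot> h = a" "?r2 \<cdot> h = b"
        using relatedE[OF R a b ab] by blast
      obtain k where k: "k \<in> Hom C Z (Dom C S)" "?s1 \<cdot> k = b" "?s2 \<cdot> k = c"
        using relatedE[OF S b c bc] by blast
      obtain u where u: "u \<in> Hom C Z (Dom C p)" "p \<cdot> u = h" "q \<cdot> u = k"
        using is_pullback_lift[OF pb r(2) s(1) h(1) k(1)] h k by metis
      show "related W a c"
        using related_comp[OF W x z W' u(1)] Comp_assoc[OF u(1) pq(1) r(1)]
          Comp_assoc[OF u(1) pq(2) s(2)] u h k by simp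
    qed
  qed
  finally show "sub_le C (rel_comp C X S R) W \<longleftrightarrow> ?all" .
qed

lemma related_rel_comp:
  assumes "relation_on C X R" "relation_on C X S"
    and "a \<in> Hom C Z X" "b \<in> Hom C Z X" "c \<in> Hom C Z X" "related R a b" "related S b c"
  shows "related (rel_comp C X S R) a c"
proof -
  note co = rel_comp_relation[OF assms(1,2)]
  have "sub_le C (rel_comp C X S R) (rel_comp C X S R)"
    using sub_le_refl HomD(1)[OF relation_onD(3)[OF co]] by blast
  then show ?thesis
    using rel_comp_le_iff[OF assms(1,2) co] assms by blast
qed

lemma reflexive_relD:
  assumes "reflexive_rel C X R"
  shows "relation_on C X R" "\<And>Z a. a \<in> Hom C Z X \<Longrightarrow> related R a a"
  using assms diagonal_le_iff by (auto simp: reflexive_rel_def)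

lemma reflexive_relI:
  "relation_on C X R \<Longrightarrow> (\<And>Z a. a \<in> Hom C Z X \<Longrightarrow> related R a a) \<Longrightarrow> reflexive_rel C X R"
  using diagonal_le_iff by (auto simp: reflexive_rel_def)

lemma reflexive_rel_upward:
  assumes "reflexive_rel C X R" "sub_le C R S" "relation_on C X S"
  shows "reflexive_rel C X S"
  using assms relation_le_trans by (auto simp: reflexive_rel_def)

lemma rel_comp_reflexive:
  assumes "reflexive_rel C X R" "reflexive_rel C X S"
  shows "reflexive_rel C X (rel_comp C X S R)"
  using reflexive_relD[OF assms(1)] reflexive_relD[OF assms(2)] related_rel_comp rel_comp_relation
  by (intro reflexive_relI) blast+

lemma le_rel_comp:
  assumes R: "reflexive_rel C X R" and S: "reflexive_rel C X S"
  shows "sub_le C R (rel_comp C X S R)" "sub_le C S (rel_comp C X S R)"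
proof -
  note R' = reflexive_relD[OF R] and S' = reflexive_relD[OF S]
  show "sub_le C R (rel_comp C X S R)"
    using related_rel_comp[OF R'(1) S'(1)] S'(2) by (blast intro: relation_leI[OF R'(1)])
  show "sub_le C S (rel_comp C X S R)"
    using related_rel_comp[OF R'(1) S'(1)] R'(2) by (blast intro: relation_leI[OF S'(1)])
qed

lemma preorder_rel_iff:
  "preorder_rel C X R \<longleftrightarrow> reflexive_rel C X R \<and>
    (\<forall>Z. \<forall>a\<in>Hom C Z X. \<forall>b\<in>Hom C Z X. \<forall>c\<in>Hom C Z X.
      related R a b \<longrightarrow> related R b c \<longrightarrow> related R a c)"
proof (cases "reflexive_rel C X R")
  case True
  note R = reflexive_relD(1)[OF True]
  show ?thesis
    unfolding preorder_rel_def rel_comp_le_iff[OF R R R] ..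
qed (simp add: preorder_rel_def)

lemma rel_comp_le_preorder:
  assumes W: "preorder_rel C X W" and R: "relation_on C X R" "sub_le C R W"
    and S: "relation_on C X S" "sub_le C S W"
  shows "sub_le C (rel_comp C X S R) W"
proof -
  have W': "relation_on C X W"
    using W reflexive_relD(1) by (auto simp: preorder_rel_def)
  show ?thesis
    using W related_mono[OF _ R(2) W'] related_mono[OF _ S(2) W']
    unfolding rel_comp_le_iff[OF R(1) S(1) W'] preorder_rel_iff by meson
qed

lemma rel_op_preorder:
  assumes R: "preorder_rel C X R"
  shows "preorder_rel C X (rel_op C X R)"
proof -
  have R': "relation_on C X R"
    using R reflexive_relD(1) by (auto simp: preorder_rel_def)
  have "reflexive_rel C X (rel_op C X R)"
    using R reflexive_relD(2) related_rel_op_iff[OF R'] rel_op_relation[OF R']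
    by (auto simp: preorder_rel_def intro!: reflexive_relI)
  then show ?thesis
    using R related_rel_op_iff[OF R'] unfolding preorder_rel_iff by meson
qed

end


section \<open>Suprema in ordered sets of subobjects\<close>

lemma is_lub_sub_order_iff:
  assumes "A \<subseteq> K"
  shows "is_lub (sub_order C K) s A \<longleftrightarrow> s \<in> K \<and> (\<forall>x\<in>A. sub_le C x s) \<and>
    (\<forall>u\<in>K. (\<forall>x\<in>A. sub_le C x u) \<longrightarrow> sub_le C s u)"
proof -
  have "Upper (sub_order C K) A = {u \<in> K. \<forall>x\<in>A. sub_le C x u}"
    using assms by (auto simp: Upper_def sub_order_def)
  then show ?thesis
    by (auto simp: least_def sub_order_def)
qed

lemma is_chain_sub_order_iff:
  "is_chain (sub_order C K) A \<longleftrightarrow> (\<forall>i. A i \<in> K) \<and> (\<forall>i j. i \<le> j \<longrightarrow> sub_le C (A i) (A j))"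
  by (simp add: is_chain_def sub_order_def)

lemma is_chain_sup_sub_order_iff:
  "is_chain_sup (sub_order C K) A s \<longleftrightarrow> is_chain (sub_order C K) A \<and> s \<in> K \<and>
    (\<forall>i. sub_le C (A i) s) \<and> (\<forall>u\<in>K. (\<forall>i. sub_le C (A i) u) \<longrightarrow> sub_le C s u)"
proof (cases "is_chain (sub_order C K) A")
  case True
  then have "range A \<subseteq> K"
    by (auto simp: is_chain_sub_order_iff)
  then show ?thesis
    using True by (simp add: is_chain_sup_def is_lub_sub_order_iff)
qed (simp add: is_chain_sup_def)


lemma is_chain_sup_Sub_iff:
  "is_chain_sup (Sub C X) A s \<longleftrightarrow> is_chain (Sub C X) A \<and> is_mono C s \<and> Cod C s = X \<and>
    (\<forall>i. sub_le C (A i) s) \<and>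
    (\<forall>u. is_mono C u \<longrightarrow> Cod C u = X \<longrightarrow> (\<forall>i. sub_le C (A i) u) \<longrightarrow> sub_le C s u)"
  by (auto simp: Sub_def is_chain_sup_sub_order_iff)

lemma is_chain_Sub_Hom:
  assumes "is_chain (Sub C X) A"
  shows "is_mono C (A i)" "A i \<in> Hom C (Dom C (A i)) X"
  using assms by (auto simp: Sub_def is_chain_sub_order_iff is_mono_def Hom_def)

context regular_category
begin

lemma is_chain_ReflexiveRels_Sub:
  assumes "is_chain (ReflexiveRels C X) R"
  shows "is_chain (Sub C (square C X)) R"
  using assms
  by (auto simp: ReflexiveRels_def Sub_def is_chain_sub_order_iff reflexive_rel_def relation_on_def)

text \<open>Every subobject above a reflexive relation is reflexive, so a non-empty family of reflexive
  relations has the same upper bounds, hence the same supremum, in both ordered sets.\<close>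

lemma is_chain_sup_ReflexiveRels_iff:
  assumes X: "X \<in> Obj C" and R: "is_chain (ReflexiveRels C X) R"
  shows "is_chain_sup (ReflexiveRels C X) R S \<longleftrightarrow> is_chain_sup (Sub C (square C X)) R S"
proof -
  have "reflexive_rel C X (R 0)"
    using R by (simp add: ReflexiveRels_def is_chain_sub_order_iff)
  then have "reflexive_rel C X U \<longleftrightarrow> is_mono C U \<and> Cod C U = square C X"
    if "\<forall>i. sub_le C (R i) U" for U
    using reflexive_rel_upward that X by (auto simp: reflexive_rel_def relation_on_def)
  then show ?thesis
    using R is_chain_ReflexiveRels_Sub[OF R]
    unfolding is_chain_sup_Sub_iff ReflexiveRels_def is_chain_sup_sub_order_iff by auto
qed

lemma reflexive_legs_split_epi:
  assumes T: "reflexive_rel C X T"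
  shows "split_epi C (proj1 C X \<cdot> T)" "split_epi C (proj2 C X \<cdot> T)"
proof -
  note T' = reflexive_relD[OF T]
  note i = Ide_Hom[OF relation_onD(1)[OF T'(1)]]
  obtain s where "s \<in> Hom C X (Dom C T)" "(proj1 C X \<cdot> T) \<cdot> s = Ide C X"
    "(proj2 C X \<cdot> T) \<cdot> s = Ide C X"
    using relatedE[OF T'(1) i i T'(2)[OF i]] by blast
  then show "split_epi C (proj1 C X \<cdot> T)" "split_epi C (proj2 C X \<cdot> T)"
    using HomD[OF relation_legs_Hom(1)[OF T'(1)]] HomD[OF relation_legs_Hom(2)[OF T'(1)]]
    unfolding split_epi_def by auto
qed

text \<open>If \<open>d\<close> is a split epimorphism then so are \<open>d \<times> 1\<close> and \<open>1 \<times> d\<close>. The latter is taken with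
  the factors of its domain exchanged, so that both are defined on the same product.\<close>

lemma pairing_split_epi:
  assumes pr: "is_product C A X t x" and d: "d \<in> Hom C A X" "split_epi C d"
  shows "split_epi C (pairing C (d \<cdot> t) x)" "split_epi C (pairing C x (d \<cdot> t))"
proof -
  define P where "P = Dom C t"
  have t: "t \<in> Hom C P A" and x: "x \<in> Hom C P X"
    using pr unfolding is_product_def P_def Hom_def by auto
  obtain s where s: "s \<in> Hom C X A" "d \<cdot> s = Ide C X"
    using d by (auto simp: split_epi_def Hom_def)
  note X = Hom_Obj(2)[OF x]
  note pj = proj_Hom[OF X]
  have dt: "d \<cdot> t \<in> Hom C P X"
    using Comp_Hom[OF t d(1)] .
  have lift: "\<exists>u\<in>Hom C Z P. (d \<cdot> t) \<cdot> u = b \<and> x \<cdot> u = c"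
    if b: "b \<in> Hom C Z X" and c: "c \<in> Hom C Z X" for Z b c
  proof -
    obtain u where u: "u \<in> Hom C Z P" "t \<cdot> u = s \<cdot> b" "x \<cdot> u = c"
      using pr Comp_Hom[OF b s(1)] c unfolding is_product_def P_def by blast
    have "(d \<cdot> t) \<cdot> u = b"
      using Comp_assoc[OF u(1) t d(1)] Comp_assoc[OF b s(1) d(1)] u(2) s(2) Ide_Comp[OF b] by simp
    then show ?thesis
      using u by blast
  qed
  have pair: "pairing C (proj1 C X) (proj2 C X) = Ide C (square C X)"
    using pairing_proj[OF X Ide_Hom[OF square_Obj[OF X]]] pj Comp_Ide by simp
  obtain u where u: "u \<in> Hom C (square C X) P" "(d \<cdot> t) \<cdot> u = proj1 C X" "x \<cdot> u = proj2 C X"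
    using lift[OF pj] by blast
  then show "split_epi C (pairing C (d \<cdot> t) x)"
    using pairing_comp[OF dt x u(1)] pair HomD[OF pairing_Hom(1)[OF dt x]]
    unfolding split_epi_def by auto
  obtain v where v: "v \<in> Hom C (square C X) P" "(d \<cdot> t) \<cdot> v = proj2 C X" "x \<cdot> v = proj1 C X"
    using lift[OF pj(2,1)] by blast
  then show "split_epi C (pairing C x (d \<cdot> t))"
    using pairing_comp[OF x dt v(1)] pair HomD[OF pairing_Hom(1)[OF x dt]]
    unfolding split_epi_def by auto
qed

end

locale chain_complete_regular_category = regular_category +
  assumes chain_sup_exists:
      "X \<in> Obj C \<Longrightarrow> is_chain (Sub C X) A \<Longrightarrow> \<exists>S. is_chain_sup (Sub C X) A S"
    and chain_sup_inverse_image: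
      "g \<in> Hom C Z X \<Longrightarrow> split_epi C g \<Longrightarrow> is_chain_sup (Sub C X) A S \<Longrightarrow>
        is_chain_sup (Sub C Z) (\<lambda>i. inverse_image C g (A i)) (inverse_image C g S)"
begin

text \<open>The subobject \<open>h\<^sup>-\<^sup>1(W)\<close> contains every \<open>g\<^sup>-\<^sup>1(A\<^sub>i)\<close>, hence contains their supremum
  \<open>g\<^sup>-\<^sup>1(S)\<close>. In other words, taking inverse images along a split epimorphism \<open>g\<close> and then direct
  images along an arbitrary \<open>h\<close> preserves suprema of chains: the first by hypothesis, the second
  because it is a left adjoint.\<close>

lemma chain_sup_transfer:
  assumes sup: "is_chain_sup (Sub C Q) A S" and g: "g \<in> Hom C P Q" "split_epi C g"
    and h: "h \<in> Hom C P Q'" and W: "is_mono C W" "W \<in> Hom C B Q'"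
    and le: "\<And>i V v. v \<in> Hom C V P \<Longrightarrow> sub_le C (g \<cdot> v) (A i) \<Longrightarrow> sub_le C (h \<cdot> v) W"
    and z: "z \<in> Hom C Z P" "sub_le C (g \<cdot> z) S"
  shows "sub_le C (h \<cdot> z) W"
proof -
  let ?U = "inverse_image C h W"
  note U = inverse_image_mono[OF h W]
  have S: "S \<in> Hom C (Dom C S) Q"
    using sup by (auto simp: is_chain_sup_Sub_iff is_mono_def Hom_def)
  have "sub_le C (inverse_image C g (A i)) ?U" for i
  proof -
    have "is_chain (Sub C Q) A"
      using sup by (simp add: is_chain_sup_def)
    note A = is_chain_Sub_Hom[OF this]
    note m = inverse_image_mono(2)[OF g(1) A]
    have "sub_le C (g \<cdot> inverse_image C g (A i)) (A i)"
      using sub_le_inverse_image_iff[OF g(1) A(2) m] sub_le_refl[OF HomD(1)[OF m]] by simp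
    then show ?thesis
      using le[OF m] sub_le_inverse_image_iff[OF h W(2) m] by simp
  qed
  then have "sub_le C (inverse_image C g S) ?U"
    using chain_sup_inverse_image[OF g sup] U HomD(3)[OF U(2)] by (simp add: is_chain_sup_Sub_iff)
  moreover have "sub_le C z (inverse_image C g S)"
    using sub_le_inverse_image_iff[OF g(1) S z(1)] z(2) by simp
  ultimately have "sub_le C z ?U"
    using sub_le_trans HomD(1)[OF U(2)] by blast
  then show ?thesis
    using sub_le_inverse_image_iff[OF h W(2) z(1)] by simp
qed


section \<open>Suprema of chains and composition\<close>

text \<open>The pairs of \<open>a T b\<close> and \<open>b R c\<close> form the inverse image of \<open>R\<close> along \<open>d\<^sub>1 \<times> 1\<close>, from
  \<open>T \<times> X\<close> to \<open>X \<times> X\<close>, and the composite is its direct image along \<open>d\<^sub>0 \<times> 1\<close>, where \<open>d\<^sub>0\<close> and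
  \<open>d\<^sub>1\<close> are the legs of \<open>T\<close>. As \<open>T\<close> is reflexive, \<open>d\<^sub>1\<close> is a split epimorphism.\<close>

lemma chain_sup_compose_right:
  assumes sup: "is_chain_sup (Sub C (square C X)) R S" and T: "reflexive_rel C X T"
    and W: "relation_on C X W"
    and le: "\<And>i Z a b c. a \<in> Hom C Z X \<Longrightarrow> b \<in> Hom C Z X \<Longrightarrow> c \<in> Hom C Z X \<Longrightarrow>
      related T a b \<Longrightarrow> related (R i) b c \<Longrightarrow> related W a c"
    and a: "a \<in> Hom C Z X" and b: "b \<in> Hom C Z X" and c: "c \<in> Hom C Z X"
    and ab: "related T a b" and bc: "related S b c"
  shows "related W a c"
proof -
  note T' = reflexive_relD(1)[OF T]
  note X = relation_onD(1)[OF T']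
  note l = relation_legs_Hom[OF T']
  let ?d0 = "proj1 C X \<cdot> T" and ?d1 = "proj2 C X \<cdot> T"
  obtain t x where pr: "is_product C (Dom C T) X t x"
    using product_exists[OF Hom_Obj(1)[OF l(1)] X] by blast
  define P where "P = Dom C t"
  have t: "t \<in> Hom C P (Dom C T)" and x: "x \<in> Hom C P X"
    using pr unfolding is_product_def P_def Hom_def by auto
  have dt: "?d0 \<cdot> t \<in> Hom C P X" "?d1 \<cdot> t \<in> Hom C P X"
    using Comp_Hom[OF t] l by blast+
  obtain k where k: "k \<in> Hom C Z (Dom C T)" "?d0 \<cdot> k = a" "?d1 \<cdot> k = b"
    using relatedE[OF T' a b ab] by blast
  obtain z where z: "z \<in> Hom C Z P" "t \<cdot> z = k" "x \<cdot> z = c"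
    using pr k(1) c unfolding is_product_def P_def by blast
  have dz: "(?d0 \<cdot> t) \<cdot> z = a" "(?d1 \<cdot> t) \<cdot> z = b"
    using Comp_assoc[OF z(1) t] l z k by auto
  have "sub_le C (pairing C (?d0 \<cdot> t) x \<cdot> z) W"
  proof (rule chain_sup_transfer[OF sup])
    show "pairing C (?d1 \<cdot> t) x \<in> Hom C P (square C X)" "pairing C (?d0 \<cdot> t) x \<in> Hom C P (square C X)"
      using pairing_Hom(1) dt x by blast+
    show "split_epi C (pairing C (?d1 \<cdot> t) x)"
      using pairing_split_epi(1)[OF pr l(2) reflexive_legs_split_epi(2)[OF T]] .
    show "is_mono C W" "W \<in> Hom C (Dom C W) (square C X)"
      using relation_onD[OF W] by simp_all
    show "z \<in> Hom C Z P" "sub_le C (pairing C (?d1 \<cdot> t) x \<cdot> z) S"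
      using z pairing_comp[OF dt(2) x z(1)] dz bc by simp_all
  next
    fix i V v
    assume v: "v \<in> Hom C V P" and vR: "sub_le C (pairing C (?d1 \<cdot> t) x \<cdot> v) (R i)"
    note tv = Comp_Hom[OF v t]
    have "related T ((?d0 \<cdot> t) \<cdot> v) ((?d1 \<cdot> t) \<cdot> v)"
      using related_comp[OF T' l related_legs[OF T'] tv] Comp_assoc[OF v t] l by auto
    then show "sub_le C (pairing C (?d0 \<cdot> t) x \<cdot> v) W"
      using le[OF Comp_Hom[OF v dt(1)] Comp_Hom[OF v dt(2)] Comp_Hom[OF v x]] vR
        pairing_comp[OF dt(1) x v] pairing_comp[OF dt(2) x v] by simp
  qed
  then show ?thesis
    using pairing_comp[OF dt(1) x z(1)] dz z(3) by simp
qed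

text \<open>For the other variable the legs of \<open>T\<close> exchange their roles, and \<open>T \<times> X\<close> is mapped to
  \<open>X \<times> X\<close> with the factors exchanged, since \<open>T\<close> now comes second.\<close>

lemma chain_sup_compose_left:
  assumes sup: "is_chain_sup (Sub C (square C X)) R S" and T: "reflexive_rel C X T"
    and W: "relation_on C X W"
    and le: "\<And>i Z a b c. a \<in> Hom C Z X \<Longrightarrow> b \<in> Hom C Z X \<Longrightarrow> c \<in> Hom C Z X \<Longrightarrow>
      related (R i) a b \<Longrightarrow> related T b c \<Longrightarrow> related W a c"
    and a: "a \<in> Hom C Z X" and b: "b \<in> Hom C Z X" and c: "c \<in> Hom C Z X"
    and ab: "related S a b" and bc: "related T b c"
  shows "related W a c"
proof -
  note T' = reflexive_relD(1)[OF T]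
  note X = relation_onD(1)[OF T']
  note l = relation_legs_Hom[OF T']
  let ?d0 = "proj1 C X \<cdot> T" and ?d1 = "proj2 C X \<cdot> T"
  obtain t x where pr: "is_product C (Dom C T) X t x"
    using product_exists[OF Hom_Obj(1)[OF l(1)] X] by blast
  define P where "P = Dom C t"
  have t: "t \<in> Hom C P (Dom C T)" and x: "x \<in> Hom C P X"
    using pr unfolding is_product_def P_def Hom_def by auto
  have dt: "?d0 \<cdot> t \<in> Hom C P X" "?d1 \<cdot> t \<in> Hom C P X"
    using Comp_Hom[OF t] l by blast+
  obtain k where k: "k \<in> Hom C Z (Dom C T)" "?d0 \<cdot> k = b" "?d1 \<cdot> k = c"
    using relatedE[OF T' b c bc] by blast
  obtain z where z: "z \<in> Hom C Z P" "t \<cdot> z = k" "x \<cdot> z = a"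
    using pr k(1) a unfolding is_product_def P_def by blast
  have dz: "(?d0 \<cdot> t) \<cdot> z = b" "(?d1 \<cdot> t) \<cdot> z = c"
    using Comp_assoc[OF z(1) t] l z k by auto
  have "sub_le C (pairing C x (?d1 \<cdot> t) \<cdot> z) W"
  proof (rule chain_sup_transfer[OF sup])
    show "pairing C x (?d0 \<cdot> t) \<in> Hom C P (square C X)" "pairing C x (?d1 \<cdot> t) \<in> Hom C P (square C X)"
      using pairing_Hom(1) dt x by blast+
    show "split_epi C (pairing C x (?d0 \<cdot> t))"
      using pairing_split_epi(2)[OF pr l(1) reflexive_legs_split_epi(1)[OF T]] .
    show "is_mono C W" "W \<in> Hom C (Dom C W) (square C X)"
      using relation_onD[OF W] by simp_all
    show "z \<in> Hom C Z P" "sub_le C (pairing C x (?d0 \<cdot> t) \<cdot> z) S"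
      using z pairing_comp[OF x dt(1) z(1)] dz ab by simp_all
  next
    fix i V v
    assume v: "v \<in> Hom C V P" and vR: "sub_le C (pairing C x (?d0 \<cdot> t) \<cdot> v) (R i)"
    note tv = Comp_Hom[OF v t]
    have "related T ((?d0 \<cdot> t) \<cdot> v) ((?d1 \<cdot> t) \<cdot> v)"
      using related_comp[OF T' l related_legs[OF T'] tv] Comp_assoc[OF v t] l by auto
    then show "sub_le C (pairing C x (?d1 \<cdot> t) \<cdot> v) W"
      using le[OF Comp_Hom[OF v x] Comp_Hom[OF v dt(1)] Comp_Hom[OF v dt(2)]] vR
        pairing_comp[OF x dt(1) v] pairing_comp[OF x dt(2) v] by simp
  qed
  then show ?thesis
    using pairing_comp[OF x dt(2) z(1)] dz z(3) by simp
qed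

lemma ReflexiveRels_chain_sup_exists:
  assumes "X \<in> Obj C" "is_chain (ReflexiveRels C X) R"
  shows "\<exists>S. is_chain_sup (ReflexiveRels C X) R S"
  using chain_sup_exists[OF square_Obj is_chain_ReflexiveRels_Sub] is_chain_sup_ReflexiveRels_iff
    assms by blast

lemma ReflexiveRels_chain_sup_comp:
  assumes X: "X \<in> Obj C" and sup: "is_chain_sup (ReflexiveRels C X) R S"
    and T: "reflexive_rel C X T"
  shows "is_chain_sup (ReflexiveRels C X) (\<lambda>i. rel_comp C X (R i) T) (rel_comp C X S T)"
proof -
  have chain: "is_chain (ReflexiveRels C X) R"
    using sup by (simp add: is_chain_sup_def)
  have subsup: "is_chain_sup (Sub C (square C X)) R S"
    using is_chain_sup_ReflexiveRels_iff[OF X chain] sup by simp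
  have R: "reflexive_rel C X (R i)" "i \<le> j \<Longrightarrow> sub_le C (R i) (R j)" for i j
    using chain by (simp_all add: ReflexiveRels_def is_chain_sub_order_iff)
  have S: "reflexive_rel C X S" "sub_le C (R i) S" for i
    using sup by (simp_all add: ReflexiveRels_def is_chain_sup_sub_order_iff)
  note T' = reflexive_relD(1)[OF T]
  have mono: "sub_le C (rel_comp C X A T) (rel_comp C X B T)"
    if A: "relation_on C X A" and B: "relation_on C X B" and AB: "sub_le C A B" for A B
    using rel_comp_le_iff[OF T' A rel_comp_relation[OF T' B]] related_rel_comp[OF T' B]
      related_mono[OF _ AB B] by blast
  have "sub_le C (rel_comp C X S T) W"
    if W: "reflexive_rel C X W" and le: "\<forall>i. sub_le C (rel_comp C X (R i) T) W" for W
  proof -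
    note W' = reflexive_relD(1)[OF W]
    have "related W a c" if "a \<in> Hom C Z X" "b \<in> Hom C Z X" "c \<in> Hom C Z X"
      "related T a b" "related (R i) b c" for i Z a b c
      using le rel_comp_le_iff[OF T' reflexive_relD(1)[OF R(1)] W'] that by blast
    then show ?thesis
      unfolding rel_comp_le_iff[OF T' reflexive_relD(1)[OF S(1)] W']
      using chain_sup_compose_right[OF subsup T W'] by blast
  qed
  then show ?thesis
    using R S mono rel_comp_reflexive[OF T] reflexive_relD(1)
    unfolding ReflexiveRels_def is_chain_sup_sub_order_iff is_chain_sub_order_iff by auto
qed


section \<open>Generated preorders and their joins\<close>

text \<open>The preorder generated by \<open>Q\<close> is the supremum \<open>T\<close> of the chain in which \<open>A\<^sub>0\<close> is \<open>Q\<close> and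
  \<open>A\<^sub>n\<^sub>+\<^sub>1\<close> is \<open>A\<^sub>n A\<^sub>n\<close>. Since composition preserves suprema of chains in each variable, \<open>T T\<close> is the
  supremum of all \<open>A\<^sub>i A\<^sub>j\<close>, and \<open>A\<^sub>i A\<^sub>j\<close> is contained in \<open>A\<^sub>n\<^sub>+\<^sub>1\<close> for \<open>n\<close> the maximum of \<open>i\<close> and
  \<open>j\<close>. Repeated squaring, in place of the powers of \<open>Q\<close>, avoids the associativity of
  composition.\<close>

lemma generated_preorder:
  assumes Q: "reflexive_rel C X Q"
  obtains T where "preorder_rel C X T" "sub_le C Q T"
    "\<And>W. preorder_rel C X W \<Longrightarrow> sub_le C Q W \<Longrightarrow> sub_le C T W"
proof -
  note X = relation_onD(1)[OF reflexive_relD(1)[OF Q]]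
  define A where "A = rec_nat Q (\<lambda>_ B. rel_comp C X B B)"
  have A0: "A 0 = Q" and ASuc: "A (Suc n) = rel_comp C X (A n) (A n)" for n
    by (simp_all add: A_def)
  have refl: "reflexive_rel C X (A n)" for n
    by (induction n) (simp_all add: A0 ASuc Q rel_comp_reflexive)
  note rel = reflexive_relD(1)[OF refl]
  have mono: "sub_le C (A i) (A j)" if "i \<le> j" for i j
    using that
  proof (induction j rule: dec_induct)
    case base
    then show ?case
      using sub_le_refl HomD(1)[OF relation_onD(3)[OF rel]] by blast
  next
    case (step n)
    then show ?case
      using relation_le_trans[OF step.IH _ rel] le_rel_comp(1)[OF refl refl] ASuc by metis
  qed
  have chain: "is_chain (ReflexiveRels C X) A"
    using refl mono by (simp add: ReflexiveRels_def is_chain_sub_order_iff)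
  obtain T where sup: "is_chain_sup (ReflexiveRels C X) A T"
    using ReflexiveRels_chain_sup_exists[OF X chain] by blast
  have subsup: "is_chain_sup (Sub C (square C X)) A T"
    using is_chain_sup_ReflexiveRels_iff[OF X chain] sup by simp
  have T: "reflexive_rel C X T" "\<And>i. sub_le C (A i) T"
    and least: "\<And>W. reflexive_rel C X W \<Longrightarrow> \<forall>i. sub_le C (A i) W \<Longrightarrow> sub_le C T W"
    using sup by (simp_all add: ReflexiveRels_def is_chain_sup_sub_order_iff)
  note T' = reflexive_relD(1)[OF T(1)]
  have AA: "related T a c" if abc: "a \<in> Hom C Z X" "b \<in> Hom C Z X" "c \<in> Hom C Z X"
    and ab: "related (A i) a b" and bc: "related (A j) b c" for i j Z a b c
  proof -
    have "related (A (max i j)) a b" "related (A (max i j)) b c"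
      using related_mono[OF ab mono rel] related_mono[OF bc mono rel] by simp_all
    then have "related (A (Suc (max i j))) a c"
      using related_rel_comp[OF rel rel abc] ASuc by simp
    then show ?thesis
      using related_mono T(2) T' by blast
  qed
  have AT: "related T a c" if "a \<in> Hom C Z X" "b \<in> Hom C Z X" "c \<in> Hom C Z X"
    "related (A i) a b" "related T b c" for i Z a b c
    by (rule chain_sup_compose_right[OF subsup refl T' _ that]) (rule AA)
  have "related T a c" if "a \<in> Hom C Z X" "b \<in> Hom C Z X" "c \<in> Hom C Z X"
    "related T a b" "related T b c" for Z a b c
    by (rule chain_sup_compose_left[OF subsup T(1) T' _ that]) (rule AT)
  then have pre: "preorder_rel C X T"
    unfolding preorder_rel_iff using T(1) by blast
  have "sub_le C T W" if W: "preorder_rel C X W" and QW: "sub_le C Q W" for W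
  proof -
    have "sub_le C (A n) W" for n
      by (induction n) (simp_all add: A0 ASuc QW rel_comp_le_preorder[OF W rel _ rel])
    then show ?thesis
      using least W by (simp add: preorder_rel_def)
  qed
  then show ?thesis
    using that pre T(2)[of 0] A0 by metis
qed

lemma preorder_join:
  assumes R: "preorder_rel C X R" and S: "preorder_rel C X S"
  obtains T where "preorder_rel C X T" "sub_le C R T" "sub_le C S T"
    "\<And>W. preorder_rel C X W \<Longrightarrow> sub_le C R W \<Longrightarrow> sub_le C S W \<Longrightarrow> sub_le C T W"
proof -
  have R': "reflexive_rel C X R" and S': "reflexive_rel C X S"
    using R S by (simp_all add: preorder_rel_def)
  obtain T where T: "preorder_rel C X T" "sub_le C (rel_comp C X S R) T"
    "\<And>W. preorder_rel C X W \<Longrightarrow> sub_le C (rel_comp C X S R) W \<Longrightarrow> sub_le C T W"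
    using generated_preorder[OF rel_comp_reflexive[OF R' S']] by blast
  have "relation_on C X T"
    using T(1) reflexive_relD(1) by (simp add: preorder_rel_def)
  then have "sub_le C R T" "sub_le C S T"
    using relation_le_trans[OF _ T(2)] le_rel_comp[OF R' S'] by blast+
  moreover have "sub_le C T W" if "preorder_rel C X W" "sub_le C R W" "sub_le C S W" for W
    using T(3)[OF that(1)] rel_comp_le_preorder[OF that(1) _ that(2) _ that(3)]
      reflexive_relD(1)[OF R'] reflexive_relD(1)[OF S'] by blast
  ultimately show ?thesis
    using that T(1) by blast
qed

text \<open>The inequality assumed here is the one that minimality provides: when \<open>T\<close> is the least preorder
  with a property that is invariant under taking opposites, the opposite of \<open>T\<close> is another preorder
  with this property.\<close>

lemma equivalence_relI:
  assumes T: "preorder_rel C X T" and le: "sub_le C T (rel_op C X T)"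
  shows "equivalence_rel C X T"
proof -
  have T': "relation_on C X T"
    using T reflexive_relD(1) by (simp add: preorder_rel_def)
  have "sub_le C (rel_op C X T) T"
    using rel_op_le_iff[OF T' T'] related_rel_op_iff[OF T'] related_mono[OF _ le rel_op_relation[OF T']]
    by blast
  then show ?thesis
    using T by (simp add: equivalence_rel_def)
qed

lemma equivalence_rel_sym:
  assumes R: "equivalence_rel C X R" and "a \<in> Hom C Z X" "b \<in> Hom C Z X" "related R a b"
  shows "related R b a"
proof -
  have "relation_on C X R"
    using R reflexive_relD(1) by (simp add: equivalence_rel_def preorder_rel_def)
  then show ?thesis
    using assms rel_op_le_iff unfolding equivalence_rel_def by blast
qed

lemma equivalence_join:
  assumes R: "equivalence_rel C X R" and S: "equivalence_rel C X S"
  obtains T where "equivalence_rel C X T" "sub_le C R T" "sub_le C S T"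
    "\<And>W. preorder_rel C X W \<Longrightarrow> sub_le C R W \<Longrightarrow> sub_le C S W \<Longrightarrow> sub_le C T W"
proof -
  obtain T where T: "preorder_rel C X T" "sub_le C R T" "sub_le C S T"
    "\<And>W. preorder_rel C X W \<Longrightarrow> sub_le C R W \<Longrightarrow> sub_le C S W \<Longrightarrow> sub_le C T W"
    using preorder_join R S unfolding equivalence_rel_def by metis
  have T': "relation_on C X T"
    using T(1) reflexive_relD(1) by (simp add: preorder_rel_def)
  have "sub_le C U (rel_op C X T)" if U: "equivalence_rel C X U" and UT: "sub_le C U T" for U
  proof (rule relation_leI)
    show "relation_on C X U"
      using U reflexive_relD(1) by (simp add: equivalence_rel_def preorder_rel_def)
    show "related (rel_op C X T) a b"
      if "a \<in> Hom C Z X" "b \<in> Hom C Z X" "related U a b" for Z a b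
      using related_rel_op_iff[OF T'] equivalence_rel_sym[OF U] related_mono[OF _ UT T'] that by blast
  qed
  then have "sub_le C T (rel_op C X T)"
    using T(4)[OF rel_op_preorder[OF T(1)]] R S T(2,3) by blast
  then show ?thesis
    using that equivalence_relI T by blast
qed

lemma PreorderRels_lub_exists:
  assumes "preorder_rel C X R" "preorder_rel C X S"
  shows "\<exists>T. is_lub (PreorderRels C X) T {R, S}"
proof -
  obtain T where "preorder_rel C X T" "sub_le C R T" "sub_le C S T"
    "\<And>W. preorder_rel C X W \<Longrightarrow> sub_le C R W \<Longrightarrow> sub_le C S W \<Longrightarrow> sub_le C T W"
    using preorder_join[OF assms] by blast
  then have "is_lub (PreorderRels C X) T {R, S}"
    using assms unfolding PreorderRels_def by (subst is_lub_sub_order_iff) auto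
  then show ?thesis
    by blast
qed

lemma EquivalenceRels_lub_exists:
  assumes "equivalence_rel C X R" "equivalence_rel C X S"
  shows "\<exists>T. is_lub (EquivalenceRels C X) T {R, S}"
proof -
  obtain T where "equivalence_rel C X T" "sub_le C R T" "sub_le C S T"
    "\<And>W. preorder_rel C X W \<Longrightarrow> sub_le C R W \<Longrightarrow> sub_le C S W \<Longrightarrow> sub_le C T W"
    using equivalence_join[OF assms] by blast
  then have "is_lub (EquivalenceRels C X) T {R, S}"
    using assms unfolding EquivalenceRels_def
    by (subst is_lub_sub_order_iff) (auto simp: equivalence_rel_def)
  then show ?thesis
    by blast
qed


section \<open>Cocartesian maps above regular epimorphisms\<close>

lemma square_map_Hom:
  assumes f: "f \<in> Hom C X Y"
  shows "square_map C f \<in> Hom C (square C X) (square C Y)"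
    and "\<And>Z a b. a \<in> Hom C Z X \<Longrightarrow> b \<in> Hom C Z X \<Longrightarrow>
      square_map C f \<cdot> pairing C a b = pairing C (f \<cdot> a) (f \<cdot> b)"
proof -
  note pj = proj_Hom[OF Hom_Obj(1)[OF f]]
  note fp = Comp_Hom[OF pj(1) f] Comp_Hom[OF pj(2) f]
  have map: "square_map C f = pairing C (f \<cdot> proj1 C X) (f \<cdot> proj2 C X)"
    by (simp add: square_map_def HomD(2)[OF f])
  show "square_map C f \<in> Hom C (square C X) (square C Y)"
    unfolding map by (rule pairing_Hom(1)[OF fp])
  show "square_map C f \<cdot> pairing C a b = pairing C (f \<cdot> a) (f \<cdot> b)"
    if a: "a \<in> Hom C Z X" and b: "b \<in> Hom C Z X" for Z a b
    using pairing_comp[OF fp pairing_Hom(1)[OF a b]] Comp_assoc[OF pairing_Hom(1)[OF a b] _ f] pj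
      pairing_Hom(2,3)[OF a b] by (simp add: map)
qed

lemma le_inverse_image_square_iff:
  assumes f: "f \<in> Hom C X Y" and R: "relation_on C X R" and S: "relation_on C Y S"
  shows "sub_le C R (inverse_image C (square_map C f) S) \<longleftrightarrow>
    (\<forall>Z. \<forall>a\<in>Hom C Z X. \<forall>b\<in>Hom C Z X. related R a b \<longrightarrow> related S (f \<cdot> a) (f \<cdot> b))"
    (is "sub_le C R ?I \<longleftrightarrow> _")
proof -
  note ff = square_map_Hom[OF f]
  note S' = relation_onD[OF S]
  have I: "relation_on C X ?I"
    using relation_onI[OF relation_onD(1)[OF R]] inverse_image_mono[OF ff(1) S'(2,3)] by blast
  have "related ?I a b \<longleftrightarrow> related S (f \<cdot> a) (f \<cdot> b)"
    if "a \<in> Hom C Z X" "b \<in> Hom C Z X" for Z a b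
    using sub_le_inverse_image_iff[OF ff(1) S'(3) pairing_Hom(1)[OF that]] ff(2)[OF that] by simp
  then show ?thesis
    using related_mono[OF _ _ I] relation_leI[OF R, of ?I] by blast
qed

text \<open>The composite of \<open>f\<close> with the diagonal of \<open>Y\<close> is the diagonal of \<open>X\<close> followed by
  \<open>f \<times> f\<close>, hence factors through the direct image of \<open>R\<close> along \<open>f \<times> f\<close>. By orthogonality
  against the regular epimorphism \<open>f\<close> the diagonal of \<open>Y\<close> does so itself.\<close>

lemma direct_image_relation:
  assumes f: "f \<in> Hom C X Y" "regular_epi C f" and R: "reflexive_rel C X R"
  obtains D where "reflexive_rel C Y D"
    "\<And>W. relation_on C Y W \<Longrightarrow>
      sub_le C D W \<longleftrightarrow> sub_le C R (inverse_image C (square_map C f) W)"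
proof
  let ?D = "image_mono C (square_map C f \<cdot> R)"
  note R' = relation_onD[OF reflexive_relD(1)[OF R]]
  note ff = square_map_Hom(1)[OF f(1)]
  note ffR = Comp_Hom[OF R'(3) ff]
  note Y = Hom_Obj(2)[OF f(1)]
  show adj: "sub_le C ?D W \<longleftrightarrow> sub_le C R (inverse_image C (square_map C f) W)"
    if "relation_on C Y W" for W
    using image_mono_le_iff[OF ffR relation_onD(2,3)[OF that]]
      sub_le_inverse_image_iff[OF ff relation_onD(3)[OF that] R'(3)] by simp
  have D: "relation_on C Y ?D"
    using relation_onI[OF Y] image_mono_is_mono[OF ffR] by blast
  note D' = relation_onD[OF D]
  have "sub_le C R (inverse_image C (square_map C f) ?D)"
    using adj[OF D] sub_le_refl HomD(1)[OF D'(3)] by blast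
  then have "related ?D (f \<cdot> Ide C X) (f \<cdot> Ide C X)"
    using le_inverse_image_square_iff[OF f(1) reflexive_relD(1)[OF R] D] reflexive_relD(2)[OF R]
      Ide_Hom[OF R'(1)] by blast
  then have "sub_le C (diagonal C Y \<cdot> f) ?D"
    using pairing_comp[OF Ide_Hom[OF Y] Ide_Hom[OF Y] f(1)] Comp_Ide[OF f(1)] Ide_Comp[OF f(1)]
    by (simp add: diagonal_def)
  then have "sub_le C (diagonal C Y) ?D"
    using sub_le_of_regular_epi[OF f(2,1) _ D'(2,3)] pairing_Hom(1)[OF Ide_Hom[OF Y] Ide_Hom[OF Y]]
    by (simp add: diagonal_def)
  then show "reflexive_rel C Y ?D"
    using D by (simp add: reflexive_rel_def)
qed

lemma preorder_direct_image:
  assumes f: "f \<in> Hom C X Y" "regular_epi C f" and R: "reflexive_rel C X R"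
  obtains T where "preorder_rel C Y T" "sub_le C R (inverse_image C (square_map C f) T)"
    "\<And>W. preorder_rel C Y W \<Longrightarrow> sub_le C R (inverse_image C (square_map C f) W) \<Longrightarrow> sub_le C T W"
proof -
  obtain D where D: "reflexive_rel C Y D"
    "\<And>W. relation_on C Y W \<Longrightarrow>
      sub_le C D W \<longleftrightarrow> sub_le C R (inverse_image C (square_map C f) W)"
    using direct_image_relation[OF assms] by blast
  obtain T where T: "preorder_rel C Y T" "sub_le C D T"
    "\<And>W. preorder_rel C Y W \<Longrightarrow> sub_le C D W \<Longrightarrow> sub_le C T W"
    using generated_preorder[OF D(1)] by blast
  have "relation_on C Y W" if "preorder_rel C Y W" for W
    using that reflexive_relD(1) by (simp add: preorder_rel_def)
  then show ?thesis
    using that T D(2) by blast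
qed

lemma equivalence_direct_image:
  assumes f: "f \<in> Hom C X Y" "regular_epi C f" and R: "equivalence_rel C X R"
  obtains T where "equivalence_rel C Y T" "sub_le C R (inverse_image C (square_map C f) T)"
    "\<And>W. preorder_rel C Y W \<Longrightarrow> sub_le C R (inverse_image C (square_map C f) W) \<Longrightarrow> sub_le C T W"
proof -
  have R': "reflexive_rel C X R"
    using R by (simp add: equivalence_rel_def preorder_rel_def)
  obtain T where T: "preorder_rel C Y T" "sub_le C R (inverse_image C (square_map C f) T)"
    "\<And>W. preorder_rel C Y W \<Longrightarrow> sub_le C R (inverse_image C (square_map C f) W) \<Longrightarrow> sub_le C T W"
    using preorder_direct_image[OF f R'] by blast
  have T': "relation_on C Y T"
    using T(1) reflexive_relD(1) by (simp add: preorder_rel_def)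
  note Rr = reflexive_relD(1)[OF R']
  have "related (rel_op C Y T) (f \<cdot> a) (f \<cdot> b)"
    if a: "a \<in> Hom C Z X" and b: "b \<in> Hom C Z X" and ab: "related R a b" for Z a b
    using T(2) equivalence_rel_sym[OF R a b ab] a b
      related_rel_op_iff[OF T' Comp_Hom[OF a f(1)] Comp_Hom[OF b f(1)]]
    unfolding le_inverse_image_square_iff[OF f(1) Rr T'] by blast
  then have "sub_le C R (inverse_image C (square_map C f) (rel_op C Y T))"
    unfolding le_inverse_image_square_iff[OF f(1) Rr rel_op_relation[OF T']] by blast
  then show ?thesis
    using that equivalence_relI[OF T(1)] T rel_op_preorder[OF T(1)] by blast
qed

text \<open>Arrows of \<open>Ref_cat C\<close> are determined by their ends and their underlying arrow, so an arrow
  above \<open>f\<close> is cocartesian as soon as its codomain is the least object above the codomain of \<open>f\<close>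
  to which \<open>f\<close> lifts.\<close>

lemma cocartesian_full_subcategoryI:
  assumes K: "\<And>X R. (X, R) \<in> K \<Longrightarrow> reflexive_rel C X R"
    and f: "f \<in> Hom C X Y" and R: "(X, R) \<in> K" and T: "(Y, T) \<in> K"
    and le: "sub_le C R (inverse_image C (square_map C f) T)"
    and least: "\<And>W. (Y, W) \<in> K \<Longrightarrow> sub_le C R (inverse_image C (square_map C f) W) \<Longrightarrow> sub_le C T W"
  shows "cocartesian (full_subcategory (Ref_cat C) K) C ground_obj ground_arr ((X, R), (Y, T), f)"
    (is "cocartesian ?K C _ _ ?f")
  unfolding cocartesian_def
proof (intro conjI ballI impI)
  have Arr: "((A, U), (B, V), h) \<in> Arr ?K \<longleftrightarrow> (A, U) \<in> K \<and> (B, V) \<in> K \<and> h \<in> Hom C A B \<and>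
      sub_le C U (inverse_image C (square_map C h) V)" for A U B V h
    using K by (auto simp: full_subcategory_def Ref_cat_def)
  have Dom_Cod: "Dom ?K (a, b, h) = a" "Cod ?K (a, b, h) = b" for a b h
    by (simp_all add: full_subcategory_def Ref_cat_def)
  have Comp: "(b', c, k) \<cdot>\<^bsub>?K\<^esub> (a, b, h) = (a, c, k \<cdot> h)" for a b b' c h k
    by (simp add: full_subcategory_def Ref_cat_def)
  show "?f \<in> Arr ?K"
    using Arr R T f le by blast
  fix \<phi>
  assume \<phi>: "\<phi> \<in> Arr ?K" "Dom ?K \<phi> = Dom ?K ?f \<and> ground_arr \<phi> = ground_arr ?f"
  obtain Y' W where \<phi>_eq: "\<phi> = ((X, R), (Y', W), f)"
    using \<phi>(2) by (cases \<phi>) (auto simp: Dom_Cod ground_arr_def)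
  have Y': "Y' = Y"
    using \<phi>(1) Arr HomD(3)[OF f] HomD(3) unfolding \<phi>_eq by metis
  have W: "(Y, W) \<in> K" "sub_le C R (inverse_image C (square_map C f) W)"
    using \<phi>(1) Arr unfolding \<phi>_eq Y' by blast+
  have i: "Ide C Y \<in> Hom C Y Y"
    using Ide_Hom[OF Hom_Obj(2)[OF f]] .
  have T': "relation_on C Y T" and W': "relation_on C Y W"
    using K T W(1) reflexive_relD(1) by blast+
  have "sub_le C T (inverse_image C (square_map C (Ide C Y)) W)"
    unfolding le_inverse_image_square_iff[OF i T' W']
    using related_mono[OF _ least[OF W] W'] Ide_Comp by simp
  then have \<psi>: "((Y, T), (Y, W), Ide C Y) \<in> Arr ?K"
    using Arr T W(1) i by blast
  show "\<exists>!\<psi>. \<psi> \<in> Hom ?K (Cod ?K ?f) (Cod ?K \<phi>) \<and> \<psi> \<cdot>\<^bsub>?K\<^esub> ?f = \<phi> \<and>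
      ground_arr \<psi> = Ide C (ground_obj (Cod ?K ?f))"
  proof (rule ex1I[of _ "((Y, T), (Y, W), Ide C Y)"])
    show "((Y, T), (Y, W), Ide C Y) \<in> Hom ?K (Cod ?K ?f) (Cod ?K \<phi>) \<and>
        ((Y, T), (Y, W), Ide C Y) \<cdot>\<^bsub>?K\<^esub> ?f = \<phi> \<and>
        ground_arr ((Y, T), (Y, W), Ide C Y) = Ide C (ground_obj (Cod ?K ?f))"
      using \<psi> Ide_Comp[OF f]
      by (simp add: Hom_def[of ?K] Dom_Cod Comp \<phi>_eq Y' ground_arr_def ground_obj_def)
    fix \<psi>
    assume "\<psi> \<in> Hom ?K (Cod ?K ?f) (Cod ?K \<phi>) \<and> \<psi> \<cdot>\<^bsub>?K\<^esub> ?f = \<phi> \<and>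
        ground_arr \<psi> = Ide C (ground_obj (Cod ?K ?f))"
    then show "\<psi> = ((Y, T), (Y, W), Ide C Y)"
      by (cases \<psi>) (auto simp: Hom_def Dom_Cod \<phi>_eq Y' ground_arr_def ground_obj_def)
  qed
qed

lemma PrO_cocartesian:
  assumes f: "f \<in> Hom C X Y" "regular_epi C f" and R: "(X, R) \<in> Obj (PrO_cat C)"
  shows "\<exists>\<phi>. cocartesian (PrO_cat C) C ground_obj ground_arr \<phi> \<and>
    Dom (PrO_cat C) \<phi> = (X, R) \<and> ground_arr \<phi> = f"
proof -
  have R': "preorder_rel C X R"
    using R by (simp add: PrO_cat_def full_subcategory_def)
  then obtain T where T: "preorder_rel C Y T" "sub_le C R (inverse_image C (square_map C f) T)"
    "\<And>W. preorder_rel C Y W \<Longrightarrow> sub_le C R (inverse_image C (square_map C f) W) \<Longrightarrow> sub_le C T W"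
    using preorder_direct_image[OF f] unfolding preorder_rel_def by metis
  have "cocartesian (PrO_cat C) C ground_obj ground_arr ((X, R), (Y, T), f)"
    unfolding PrO_cat_def
    by (rule cocartesian_full_subcategoryI) (use f R' T in \<open>simp_all add: preorder_rel_def\<close>)
  moreover have "Dom (PrO_cat C) ((X, R), (Y, T), f) = (X, R)"
    by (simp add: PrO_cat_def full_subcategory_def Ref_cat_def)
  ultimately show ?thesis
    unfolding ground_arr_def by (metis case_prod_conv)
qed

lemma Equ_cocartesian:
  assumes f: "f \<in> Hom C X Y" "regular_epi C f" and R: "(X, R) \<in> Obj (Equ_cat C)"
  shows "\<exists>\<phi>. cocartesian (Equ_cat C) C ground_obj ground_arr \<phi> \<and>
    Dom (Equ_cat C) \<phi> = (X, R) \<and> ground_arr \<phi> = f"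
proof -
  have R': "equivalence_rel C X R"
    using R by (simp add: Equ_cat_def full_subcategory_def)
  then obtain T where T: "equivalence_rel C Y T" "sub_le C R (inverse_image C (square_map C f) T)"
    "\<And>W. preorder_rel C Y W \<Longrightarrow> sub_le C R (inverse_image C (square_map C f) W) \<Longrightarrow> sub_le C T W"
    using equivalence_direct_image[OF f] by metis
  have "cocartesian (Equ_cat C) C ground_obj ground_arr ((X, R), (Y, T), f)"
    unfolding Equ_cat_def
    by (rule cocartesian_full_subcategoryI)
      (use f R' T in \<open>simp_all add: equivalence_rel_def preorder_rel_def\<close>)
  moreover have "Dom (Equ_cat C) ((X, R), (Y, T), f) = (X, R)"
    by (simp add: Equ_cat_def full_subcategory_def Ref_cat_def)
  ultimately show ?thesis
    unfolding ground_arr_def by (metis case_prod_conv)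
qed

end


section \<open>Chains of reflexive relations, preorders and equivalence relations\<close>

theorem proposition4p1:
  fixes E :: "('o, 'a, 'm) cat_scheme"
  assumes "regular_category E"
    and "\<And>X A. X \<in> Obj E \<Longrightarrow> is_chain (Sub E X) A \<Longrightarrow> \<exists>S. is_chain_sup (Sub E X) A S"
    and "\<And>Z X g A S. g \<in> Hom E Z X \<Longrightarrow> split_epi E g \<Longrightarrow> is_chain_sup (Sub E X) A S \<Longrightarrow>
           is_chain_sup (Sub E Z) (\<lambda>i. inverse_image E g (A i)) (inverse_image E g S)"
  shows
    "(\<forall>X\<in>Obj E. \<forall>R. is_chain (ReflexiveRels E X) R \<longrightarrow>
        (\<exists>S. is_chain_sup (ReflexiveRels E X) R S)) \<and>
     (\<forall>X\<in>Obj E. \<forall>R S T. is_chain_sup (ReflexiveRels E X) R S \<and> reflexive_rel E X T \<longrightarrow>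
        is_chain_sup (ReflexiveRels E X) (\<lambda>i. rel_comp E X (R i) T) (rel_comp E X S T)) \<and>
     (\<forall>X\<in>Obj E. \<forall>R S. preorder_rel E X R \<and> preorder_rel E X S \<longrightarrow>
        (\<exists>T. is_lub (PreorderRels E X) T {R, S})) \<and>
     (\<forall>X\<in>Obj E. \<forall>R S. equivalence_rel E X R \<and> equivalence_rel E X S \<longrightarrow>
        (\<exists>T. is_lub (EquivalenceRels E X) T {R, S})) \<and>
     (\<forall>X Y f R. f \<in> Hom E X Y \<and> regular_epi E f \<and> (X, R) \<in> Obj (PrO_cat E) \<longrightarrow>
        (\<exists>\<phi>. cocartesian (PrO_cat E) E ground_obj ground_arr \<phi> \<and>
             Dom (PrO_cat E) \<phi> = (X, R) \<and> ground_arr \<phi> = f)) \<and>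
     (\<forall>X Y f R. f \<in> Hom E X Y \<and> regular_epi E f \<and> (X, R) \<in> Obj (Equ_cat E) \<longrightarrow>
        (\<exists>\<phi>. cocartesian (Equ_cat E) E ground_obj ground_arr \<phi> \<and>
             Dom (Equ_cat E) \<phi> = (X, R) \<and> ground_arr \<phi> = f))"
proof -
  interpret chain_complete_regular_category E
    by (intro chain_complete_regular_category.intro chain_complete_regular_category_axioms.intro
        assms)
  show ?thesis
    by (intro conjI allI ballI impI; (elim conjE)?;
        rule ReflexiveRels_chain_sup_exists ReflexiveRels_chain_sup_comp PreorderRels_lub_exists
          EquivalenceRels_lub_exists PrO_cocartesian Equ_cocartesian; assumption)
qed

end
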